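(* Let $G$ be a graph with $n$ vertices and without an induced copy of $K_4$. Then $\tilde b(G)\le 2^{n/3}$. If, in addition, $G$ contains a vertex of degree at most $3$ which does not lie in a connected component of $G$ consisting of a single triangle, then $$\tilde b(G)\le(\Theta_2^{-4}+\Theta_2^{-5}+\Theta_2^{-6})\Theta_2^n,\qquad \Theta_2=2^{1/3}.$$
   Context: $\mathrm{Ind}(G)$ is the independence complex of $G$ (including the empty face), and $\tilde b(G)=\sum_{i\ge-1}\dim_{\mathbb{K}}\widetilde H_i(\mathrm{Ind}(G);\mathbb{K})$ for a fixed field $\mathbb{K}$. *)

theory Defs
  imports Complex_Main
begin

definition simple_graph :: "'a set \<Rightarrow> 'a set set \<Rightarrow> bool" where
  "simple_graph V E \<longleftrightarrow> finite V \<and> (\<forall>e\<in>E. e \<subseteq> V \<and> card e = 2)"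

definition adj :: "'a set set \<Rightarrow> 'a \<Rightarrow> 'a \<Rightarrow> bool" where
  "adj E u v \<longleftrightarrow> {u, v} \<in> E"

definition degree :: "'a set set \<Rightarrow> 'a \<Rightarrow> nat" where
  "degree E v = card {u. adj E v u}"

definition component :: "'a set \<Rightarrow> 'a set set \<Rightarrow> 'a \<Rightarrow> 'a set" where
  "component V E v = {u. (\<lambda>x y. x \<in> V \<and> y \<in> V \<and> adj E x y)\<^sup>*\<^sup>* v u}"

definition triangle_component :: "'a set \<Rightarrow> 'a set set \<Rightarrow> 'a \<Rightarrow> bool" where
  "triangle_component V E v \<longleftrightarrow> card (component V E v) = 3 \<and>
     (\<forall>x\<in>component V E v. \<forall>y\<in>component V E v. x \<noteq> y \<longrightarrow> adj E x y)"

definition K4_free :: "'a set \<Rightarrow> 'a set set \<Rightarrow> bool" where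
  "K4_free V E \<longleftrightarrow> \<not> (\<exists>S\<subseteq>V. card S = 4 \<and> (\<forall>x\<in>S. \<forall>y\<in>S. x \<noteq> y \<longrightarrow> adj E x y))"

text \<open>Faces of the independence complex (including the empty face).\<close>
definition indep_face :: "'a set \<Rightarrow> 'a set set \<Rightarrow> 'a set \<Rightarrow> bool" where
  "indep_face V E S \<longleftrightarrow> S \<subseteq> V \<and> (\<forall>e\<in>E. \<not> e \<subseteq> S)"

text \<open>Chain space: K-valued functions on faces with k vertices (dimension k-1).\<close>
definition chains :: "'k::field itself \<Rightarrow> 'a set \<Rightarrow> 'a set set \<Rightarrow> nat \<Rightarrow> ('a set \<Rightarrow> 'k) set" where
  "chains _ V E k = {c. \<forall>\<sigma>. c \<sigma> \<noteq> 0 \<longrightarrow> indep_face V E \<sigma> \<and> card \<sigma> = k}"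

text \<open>Simplicial boundary, vertices ordered by the linear order of 'a:
  the face \<tau> appears in \<partial>(insert v \<tau>) with sign (-1)^(position of v).\<close>
definition boundary :: "'a::linorder set \<Rightarrow> ('a set \<Rightarrow> 'k::field) \<Rightarrow> 'a set \<Rightarrow> 'k" where
  "boundary V c \<tau> = (\<Sum>v\<in>V - \<tau>. (-1) ^ card {u\<in>\<tau>. u < v} * c (insert v \<tau>))"

definition lin_indep :: "('b \<Rightarrow> 'k::field) set \<Rightarrow> bool" where
  "lin_indep S \<longleftrightarrow> finite S \<and>
     (\<forall>a. (\<forall>x. (\<Sum>f\<in>S. a f * f x) = 0) \<longrightarrow> (\<forall>f\<in>S. a f = 0))"

definition vdim :: "('b \<Rightarrow> 'k::field) set \<Rightarrow> nat" where
  "vdim W = Sup {card S | S. S \<subseteq> W \<and> lin_indep S}"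

text \<open>Reduced homology of Ind(G) in degree k-1 (faces with k vertices).\<close>
definition red_betti :: "'k::field itself \<Rightarrow> 'a::linorder set \<Rightarrow> 'a set set \<Rightarrow> nat \<Rightarrow> nat" where
  "red_betti K V E k =
     vdim {c \<in> chains K V E k. boundary V c = (\<lambda>_. 0)}
     - vdim (boundary V ` chains K V E (Suc k))"

text \<open>Total reduced Betti number, summing degrees -1 .. |V|-1.\<close>
definition btilde :: "'k::field itself \<Rightarrow> 'a::linorder set \<Rightarrow> 'a set set \<Rightarrow> nat" where
  "btilde K V E = (\<Sum>k\<le>card V. red_betti K V E k)"

end

theory Submission
  imports Defs "HOL-Library.Function_Algebras"
begin

text \<open>
  Ordering chains by whether their faces contain \<open>v\<close> makes the boundary matrix of \<open>Ind(G)\<close> block triangular,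
  with the boundaries of \<open>Ind(G - v)\<close> and \<open>Ind(G - N[v])\<close> on the diagonal; comparing ranks gives
  \<open>b(G) \<le> b(G - v) + b(G - N[v])\<close>, and \<open>b(G) = 0\<close> if \<open>G\<close> has an isolated vertex. Deleting the neighbours
  \<open>x\<^sub>1, \<dots>, x\<^sub>d\<close> of \<open>v\<close> one after the other leaves \<open>v\<close> isolated, hence
  \<open>b(G) \<le> \<Sum>\<^sub>i b(G - x\<^sub>1 - \<dots> - x\<^sub>i\<^sub>-\<^sub>1 - N[x\<^sub>i])\<close>. The \<open>i\<close>-th graph has lost \<open>N[x\<^sub>i]\<close> and every earlier \<open>x\<^sub>j\<close>
  that is not adjacent to \<open>x\<^sub>i\<close>. As \<open>G\<close> has no \<open>K\<^sub>4\<close>, the graph \<open>H\<close> induced on \<open>N(v)\<close> is triangle-free, so there are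
  many such losses. In a minimal counterexample this forces all degrees to be 4 or 5, and the few
  remaining shapes of \<open>H\<close> are excluded because some branch contains a vertex of degree at most 3
  for which a sharper bound holds.
\<close>

section \<open>Dimensions of spaces of functions\<close>

text \<open>Disjoint triangles attain the first bound: three points have \<open>btilde\<close> 2,
  and disjoint unions become joins, on which \<open>btilde\<close> is multiplicative. Hence 2^(1/3),
  and hence the exception in the second claim. That exception is also the main obstacle: a branch
  that leaves a vertex of degree at most 2 gains something only if this vertex is not in a triangle
  component. If it is, the triangle sends all its further edges into the deleted set, and since all
  degrees are at least 4 this pins down neighbourhoods until they contradict each other. With t =
  2^(-1/3), a branch losing k vertices weighs t^k. A vertex of degree at least 6 is harmless since t
  + t^7 < 1; five branches losing only six vertices each would weigh 5/4, so further losses are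
  indispensable. The constant t^4 + t^5 + t^6 is the weight of three pairwise nonadjacent neighbours
  of degree 3. Both claims share one induction: the second is proved for any graph whose proper
  induced subgraphs satisfy the first, so it applies to every branch of a minimal
  counterexample.\<close>

abbreviation (input) fscale :: "'k::field \<Rightarrow> ('b \<Rightarrow> 'k) \<Rightarrow> 'b \<Rightarrow> 'k" where
  "fscale a f \<equiv> \<lambda>x. a * f x"

interpretation fs: vector_space "fscale :: 'k::field \<Rightarrow> ('b \<Rightarrow> 'k) \<Rightarrow> 'b \<Rightarrow> 'k"
  by unfold_locales (auto simp: fun_eq_iff algebra_simps)

definition supp_on :: "'b set \<Rightarrow> ('b \<Rightarrow> 'k::field) set" where
  "supp_on X = {f. \<forall>x. f x \<noteq> 0 \<longrightarrow> x \<in> X}"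

lemma sum_fun_apply: "(\<Sum>i\<in>I. f i) x = (\<Sum>i\<in>I. f i x)"
  by (induction I rule: infinite_finite_induct) auto

lemma lin_indep_iff: "lin_indep S \<longleftrightarrow> finite S \<and> fs.independent S"
proof (cases "finite S")
  case True
  have "(\<forall>x. (\<Sum>f\<in>S. a f * f x) = 0) \<longleftrightarrow> (\<Sum>f\<in>S. fscale (a f) f) = 0" for a
    by (simp add: fun_eq_iff sum_fun_apply)
  then have "lin_indep S \<longleftrightarrow> (\<forall>a. (\<Sum>f\<in>S. fscale (a f) f) = 0 \<longrightarrow> (\<forall>f\<in>S. a f = 0))"
    by (simp only: lin_indep_def True simp_thms)
  also have "\<dots> \<longleftrightarrow> fs.independent S"
    unfolding fs.dependent_finite[OF True] by metis
  finally show ?thesis using True by simp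
qed (simp add: lin_indep_def)

lemma supp_on_spanned:
  assumes "finite X"
  obtains F :: "('b \<Rightarrow> 'k::field) set" where "finite F" "card F \<le> card X" "supp_on X \<subseteq> fs.span F"
proof
  let ?d = "\<lambda>x y. if y = x then 1 else (0::'k)"
  show "finite (?d ` X)" "card (?d ` X) \<le> card X" using assms by (simp_all add: card_image_le)
  show "supp_on X \<subseteq> fs.span (?d ` X)"
  proof
    fix f :: "'b \<Rightarrow> 'k" assume f: "f \<in> supp_on X"
    have "f = (\<Sum>x\<in>X. fscale (f x) (?d x))"
    proof
      fix y
      have "(\<Sum>x\<in>X. fscale (f x) (?d x)) y = (\<Sum>x\<in>X. if y = x then f x else 0)"
        by (simp add: sum_fun_apply if_distrib cong: if_cong)
      also have "\<dots> = f y" using f assms by (auto simp: supp_on_def)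
      finally show "f y = (\<Sum>x\<in>X. fscale (f x) (?d x)) y" by simp
    qed
    also have "\<dots> \<in> fs.span (?d ` X)"
      by (intro fs.span_sum fs.span_scale fs.span_base) auto
    finally show "f \<in> fs.span (?d ` X)" .
  qed
qed

text \<open>On natural numbers \<open>Sup\<close> is informative only for bounded sets; a finite
  spanning set bounds all independent sets, so the supremum is a maximum.\<close>

lemma vdim_eq_card:
  assumes "finite B" "B \<subseteq> W" "fs.independent B" "W \<subseteq> fs.span B"
  shows "vdim W = card B"
  unfolding vdim_def
proof (rule cSup_eq_maximum)
  show "card B \<in> {card S |S. S \<subseteq> W \<and> lin_indep S}"
    using assms by (auto simp: lin_indep_iff)
  show "n \<le> card B" if n: "n \<in> {card S |S. S \<subseteq> W \<and> lin_indep S}" for n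
  proof -
    obtain S where S: "n = card S" "S \<subseteq> W" "fs.independent S" using n unfolding lin_indep_iff by blast
    then have "S \<subseteq> fs.span B" using assms(4) by (rule_tac subset_trans)
    then show ?thesis using fs.independent_span_bound[OF assms(1) S(3)] S(1) by simp
  qed
qed

lemma finite_basis:
  assumes "finite X" "W \<subseteq> supp_on X" "S \<subseteq> W" "fs.independent S"
  obtains B where "S \<subseteq> B" "finite B" "B \<subseteq> W" "fs.independent B" "W \<subseteq> fs.span B"
proof -
  obtain B where B: "S \<subseteq> B" "B \<subseteq> W" "fs.independent B" "W \<subseteq> fs.span B"
    by (rule fs.maximal_independent_subset_extend[OF assms(3,4)])
  obtain F :: "('a \<Rightarrow> 'b) set" where "finite F" "supp_on X \<subseteq> fs.span F"
    by (rule supp_on_spanned[OF assms(1)])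
  then have "finite B"
    using fs.independent_span_bound[OF _ B(3), of F] B(2) assms(2) by auto
  with B that show ?thesis by blast
qed

lemma vdim_le_card:
  assumes "finite X" "W \<subseteq> supp_on X"
  shows "vdim W \<le> card X"
proof -
  obtain B where B: "finite B" "B \<subseteq> W" "fs.independent B" "W \<subseteq> fs.span B"
    by (rule finite_basis[OF assms empty_subsetI fs.independent_empty])
  obtain F :: "('a \<Rightarrow> 'b) set" where F: "finite F" "card F \<le> card X" "supp_on X \<subseteq> fs.span F"
    by (rule supp_on_spanned[OF assms(1)])
  have "card B \<le> card F"
    using fs.independent_span_bound[OF F(1) B(3)] B(2) F(3) assms(2) by auto
  then show ?thesis using vdim_eq_card[OF B] F(2) by simp
qed

lemma vdim_mono:
  assumes "finite X" "W \<subseteq> supp_on X" "W' \<subseteq> W"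
  shows "vdim W' \<le> vdim W"
proof -
  obtain B where B: "finite B" "B \<subseteq> W'" "fs.independent B" "W' \<subseteq> fs.span B"
    by (rule finite_basis[OF assms(1) subset_trans[OF assms(3,2)] empty_subsetI fs.independent_empty])
  obtain B' where B': "B \<subseteq> B'" "finite B'" "B' \<subseteq> W" "fs.independent B'" "W \<subseteq> fs.span B'"
    by (rule finite_basis[OF assms(1,2) subset_trans[OF B(2) assms(3)] B(3)])
  show ?thesis
    using vdim_eq_card[OF B] vdim_eq_card[OF B'(2-5)] card_mono[OF B'(2,1)] by simp
qed

text \<open>Extend a basis \<open>B\<close> of the kernel to a basis \<open>C\<close> of
  \<open>W\<close>; then \<open>T\<close> maps \<open>C - B\<close> bijectively onto a basis of the
  image.\<close>

lemma vdim_rank_nullity: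
  fixes T :: "('b \<Rightarrow> 'k::field) \<Rightarrow> ('c \<Rightarrow> 'k)"
  assumes X: "finite X" "W \<subseteq> supp_on X" and W: "fs.subspace W"
    and T: "Vector_Spaces.linear fscale fscale T"
  shows "vdim W = vdim {w \<in> W. T w = 0} + vdim (T ` W)"
proof -
  interpret T: Vector_Spaces.linear fscale fscale T by (rule T)
  interpret P: vector_space_pair "fscale :: 'k \<Rightarrow> ('b \<Rightarrow> 'k) \<Rightarrow> _" "fscale :: 'k \<Rightarrow> ('c \<Rightarrow> 'k) \<Rightarrow> _" ..
  let ?K = "{w \<in> W. T w = 0}"
  obtain B where B: "finite B" "B \<subseteq> ?K" "fs.independent B" "?K \<subseteq> fs.span B"
    by (rule finite_basis[OF X(1) _ empty_subsetI fs.independent_empty, of ?K]) (use X(2) in auto)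
  obtain C where C: "B \<subseteq> C" "finite C" "C \<subseteq> W" "fs.independent C" "W \<subseteq> fs.span C"
    by (rule finite_basis[OF X _ B(3)]) (use B(2) in auto)
  let ?D = "C - B"
  have finD: "finite ?D" using C by simp
  have spanD: "fs.span ?D \<subseteq> W" using C(3) W by (intro fs.span_minimal) auto
  have zero: "x = 0" if x: "x \<in> fs.span ?D" "T x = 0" for x
  proof -
    obtain a where a: "x = (\<Sum>v\<in>?D. fscale (a v) v)"
      using x(1) unfolding fs.span_finite[OF finD] by blast
    have "x \<in> fs.span B" using x spanD B(4) by blast
    then obtain b where b: "x = (\<Sum>v\<in>B. fscale (b v) v)"
      unfolding fs.span_finite[OF B(1)] by blast
    \<comment> \<open>\<open>x\<close> is a combination of \<open>C - B\<close> and also of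
      \<open>B\<close>; subtracting the two gives a relation on \<open>C\<close>, whose coefficients
      must vanish.\<close>
    let ?c = "\<lambda>v. if v \<in> B then - b v else a v"
    have "(\<Sum>v\<in>C. fscale (?c v) v) = (\<Sum>v\<in>?D. fscale (?c v) v) + (\<Sum>v\<in>B. fscale (?c v) v)"
      using C by (intro sum.subset_diff) auto
    also have "(\<Sum>v\<in>?D. fscale (?c v) v) = x"
      unfolding a by (intro sum.cong) auto
    also have "(\<Sum>v\<in>B. fscale (?c v) v) = - x"
      unfolding b sum_negf[symmetric] by (intro sum.cong) (auto simp: fun_eq_iff)
    finally have 0: "(\<Sum>v\<in>C. fscale (?c v) v) = 0" by (simp add: fun_eq_iff)
    have "\<forall>u. (\<Sum>v\<in>C. fscale (u v) v) = 0 \<longrightarrow> (\<forall>v\<in>C. u v = 0)"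
      using C(4) unfolding fs.dependent_finite[OF C(2)] by metis
    from this[rule_format, OF 0] have "\<forall>v\<in>C. ?c v = 0" by blast
    then have "\<forall>v\<in>?D. a v = 0" by auto
    then show "x = 0" unfolding a by (simp add: sum_fun_apply fun_eq_iff)
  qed
  have inj: "inj_on T (fs.span ?D)"
    using zero by (subst P.linear_inj_on_iff_eq_0[OF T]) (auto simp: fs.subspace_span)
  have indD: "fs.independent ?D" using C(4) fs.independent_mono by blast
  have ind: "fs.independent (T ` ?D)"
    by (rule P.linear_independent_injective_image[OF T indD inj])
  have "T ` W \<subseteq> fs.span (T ` ?D)"
  proof
    fix y assume "y \<in> T ` W"
    then have "y \<in> T ` fs.span C" using C(5) by blast
    then have "y \<in> fs.span (T ` C)" by (simp add: P.linear_span_image[OF T])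
    moreover have "T ` C \<subseteq> insert 0 (T ` ?D)" using B(2) by auto
    ultimately show "y \<in> fs.span (T ` ?D)"
      using fs.span_mono[of "T ` C" "insert 0 (T ` ?D)"] by (auto simp: fs.span_insert_0)
  qed
  then have "vdim (T ` W) = card (T ` ?D)"
    using C finD ind by (intro vdim_eq_card) auto
  also have "\<dots> = card ?D"
    using inj fs.span_superset[of ?D] by (intro card_image) (rule inj_on_subset)
  finally have "vdim (T ` W) = card ?D" .
  moreover have "vdim ?K = card B" using vdim_eq_card[OF B] .
  moreover have "vdim W = card C" using vdim_eq_card[OF C(2-5)] .
  moreover have "card C = card B + card ?D" 
    using C(1,2) B(1) by (simp add: card_Diff_subset card_mono)
  ultimately show ?thesis by simp
qed

section \<open>Deletion and link in the independence complex\<close>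

lemma minus_one_power_cancel: "(-1) ^ n * ((-1) ^ n * x) = (x :: 'k::field)"
  by (cases "even n") auto

lemma chainsI: "(\<And>\<sigma>. c \<sigma> \<noteq> 0 \<Longrightarrow> indep_face V E \<sigma> \<and> card \<sigma> = k) \<Longrightarrow> c \<in> chains K V E k"
  by (auto simp: chains_def)

lemma chains_nonface: "c \<in> chains K V E k \<Longrightarrow> \<not> indep_face V E \<sigma> \<Longrightarrow> c \<sigma> = 0"
  by (auto simp: chains_def)

lemma chains_supp: "chains K V E k \<subseteq> supp_on (Pow V)"
  by (auto simp: chains_def supp_on_def indep_face_def)

lemma subspace_chains: "fs.subspace (chains K V E k)"
  unfolding fs.subspace_def chains_def by auto (metis add.right_neutral)+

lemma linear_boundary: "Vector_Spaces.linear fscale fscale (boundary V)"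
  unfolding Vector_Spaces.linear_iff
  by (auto simp: fs.vector_space_axioms boundary_def fun_eq_iff algebra_simps sum.distrib sum_distrib_left)

lemma boundary_supp: "boundary V ` chains K V E k \<subseteq> supp_on (Pow V)"
proof -
  have "\<tau> \<subseteq> V" if c: "c \<in> chains K V E k" and nz: "boundary V c \<tau> \<noteq> 0" for c \<tau>
  proof -
    obtain v where "v \<in> V - \<tau>" "c (insert v \<tau>) \<noteq> 0"
      using nz unfolding boundary_def by (metis (no_types, lifting) mult_zero_right sum.neutral)
    then have "indep_face V E (insert v \<tau>)" using c by (auto simp: chains_def)
    then show ?thesis by (simp add: indep_face_def)
  qed
  then show ?thesis by (auto simp: supp_on_def)
qed

lemma boundary_subset:
  assumes "finite V" "V' \<subseteq> V" "c \<in> chains K V' E k"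
  shows "boundary V c = boundary V' c"
  unfolding boundary_def fun_eq_iff
  using assms by (auto intro!: sum.mono_neutral_right chains_nonface[OF assms(3)] simp: indep_face_def)

lemma chains_rank_nullity:
  assumes "finite V"
  shows "vdim (chains K V E k) =
    vdim {c \<in> chains K V E k. boundary V c = (\<lambda>_. 0)} + vdim (boundary V ` chains K V E k)"
  using vdim_rank_nullity[OF finite_Pow_iff[THEN iffD2, OF assms] chains_supp subspace_chains linear_boundary]
  by (simp add: zero_fun_def)

lemma subspace_boundary: "fs.subspace (boundary V ` chains K V E k)"
proof -
  interpret Vector_Spaces.linear fscale fscale "boundary V :: ('b set \<Rightarrow> 'a) \<Rightarrow> _" by (rule linear_boundary)
  show ?thesis by (rule subspace_image[OF subspace_chains])
qed

section \<open>Projection of chains onto the link of a vertex\<close>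

abbreviation outside :: "'a set set \<Rightarrow> 'a set \<Rightarrow> 'a \<Rightarrow> 'a set" where
  "outside E V v \<equiv> V - insert v {u. adj E v u}"

text \<open>The sign makes the projection onto the link of \<open>v\<close> commute with the boundary.\<close>
definition link_map :: "'a::linorder \<Rightarrow> ('a set \<Rightarrow> 'k::field) \<Rightarrow> 'a set \<Rightarrow> 'k" where
  "link_map v c \<sigma> = (if v \<in> \<sigma> then 0 else (-1) ^ card {u\<in>\<sigma>. v < u} * c (insert v \<sigma>))"

lemma linear_link_map: "Vector_Spaces.linear fscale fscale (link_map v)"
  unfolding Vector_Spaces.linear_iff
  by (auto simp: fs.vector_space_axioms link_map_def fun_eq_iff algebra_simps)

text \<open>An edge inside \<open>insert v \<sigma>\<close> but not inside \<open>\<sigma>\<close>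
  joins \<open>v\<close> to a neighbour. So the link of \<open>v\<close> in the independence complex
  is the independence complex of G - N[v].\<close>

lemma indep_face_insert:
  assumes "\<forall>e\<in>E. card e = 2" "v \<in> V" "v \<notin> \<sigma>"
  shows "indep_face V E (insert v \<sigma>) \<longleftrightarrow> indep_face (outside E V v) E \<sigma>"
proof
  assume "indep_face V E (insert v \<sigma>)"
  then show "indep_face (outside E V v) E \<sigma>"
    using assms by (auto simp: indep_face_def adj_def)
next
  assume *: "indep_face (outside E V v) E \<sigma>"
  have "\<not> e \<subseteq> insert v \<sigma>" if "e \<in> E" for e
  proof
    assume e: "e \<subseteq> insert v \<sigma>"
    have "v \<in> e" using * that e by (auto simp: indep_face_def)
    obtain x y where xy: "e = {x, y}" "x \<noteq> y" using assms(1) \<open>e \<in> E\<close> by (auto simp: card_2_iff)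
    then obtain u where "e = {v, u}" "u \<noteq> v" using \<open>v \<in> e\<close> by auto
    then show False using * \<open>e \<in> E\<close> e by (auto simp: indep_face_def adj_def)
  qed
  then show "indep_face V E (insert v \<sigma>)" using * assms(2) by (auto simp: indep_face_def)
qed

text \<open>The number of vertices drops by one because the link forgets \<open>v\<close>. The
  preimage \<open>c\<close> of \<open>d\<close> is the cone over \<open>d\<close> with apex
  \<open>v\<close>.\<close>

lemma link_map_chains:
  assumes E: "\<forall>e\<in>E. card e = 2" and v: "v \<in> V" and V: "finite V"
  shows "link_map v ` chains K V E (Suc k) = chains K (outside E V v) E k"
proof (intro equalityI subsetI)
  fix d assume "d \<in> link_map v ` chains K V E (Suc k)"
  then obtain c where c: "c \<in> chains K V E (Suc k)" "d = link_map v c" by blast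
  show "d \<in> chains K (outside E V v) E k"
  proof (rule chainsI)
    fix \<sigma> assume "d \<sigma> \<noteq> 0"
    then have *: "v \<notin> \<sigma>" "c (insert v \<sigma>) \<noteq> 0" by (auto simp: c link_map_def split: if_splits)
    then have f: "indep_face V E (insert v \<sigma>)" "card (insert v \<sigma>) = Suc k"
      using c by (auto simp: chains_def)
    then have "finite \<sigma>" using V by (auto simp: indep_face_def dest: finite_subset)
    then show "indep_face (outside E V v) E \<sigma> \<and> card \<sigma> = k"
      using f * indep_face_insert[OF E v] by auto
  qed
next
  fix d assume d: "d \<in> chains K (outside E V v) E k"
  define c where "c = (\<lambda>\<sigma>. if v \<in> \<sigma> then (-1) ^ card {u\<in>\<sigma>. v < u} * d (\<sigma> - {v}) else 0)"
  have "c \<in> chains K V E (Suc k)"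
  proof (rule chainsI)
    fix \<sigma> assume "c \<sigma> \<noteq> 0"
    then have *: "v \<in> \<sigma>" "d (\<sigma> - {v}) \<noteq> 0" by (auto simp: c_def split: if_splits)
    then have f: "indep_face (outside E V v) E (\<sigma> - {v})" "card (\<sigma> - {v}) = k"
      using d by (auto simp: chains_def)
    then have "finite \<sigma>" using V by (auto simp: indep_face_def dest: finite_subset)
    then have "card \<sigma> = Suc k" using f(2) card.remove[OF _ *(1)] by simp
    then show "indep_face V E \<sigma> \<and> card \<sigma> = Suc k"
      using f(1) *(1) indep_face_insert[OF E v, of "\<sigma> - {v}"] by (simp add: insert_absorb)
  qed
  moreover have "link_map v c = d"
  proof
    fix \<sigma>
    have "{u \<in> insert v \<sigma>. v < u} = {u \<in> \<sigma>. v < u}" by auto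
    moreover have "d \<sigma> = 0" if "v \<in> \<sigma>"
      using that by (intro chains_nonface[OF d]) (auto simp: indep_face_def)
    ultimately show "link_map v c \<sigma> = d \<sigma>"
      by (auto simp: link_map_def c_def minus_one_power_cancel)
  qed
  ultimately show "d \<in> link_map v ` chains K V E (Suc k)" by blast
qed

lemma link_map_kernel:
  assumes "v \<in> V" "finite V"
  shows "{c \<in> chains K V E k. link_map v c = 0} = chains K (V - {v}) E k"
proof (intro equalityI subsetI)
  fix c assume "c \<in> {c \<in> chains K V E k. link_map v c = 0}"
  then have c: "c \<in> chains K V E k" "\<And>\<sigma>. link_map v c \<sigma> = 0" by (auto simp: fun_eq_iff)
  have "c \<sigma> = 0" if "v \<in> \<sigma>" for \<sigma>
    using c(2)[of "\<sigma> - {v}"] that by (simp add: link_map_def insert_absorb)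
  then show "c \<in> chains K (V - {v}) E k"
    using c(1) by (auto simp: chains_def indep_face_def)
next
  fix c assume c: "c \<in> chains K (V - {v}) E k"
  have "link_map v c = 0"
    using chains_nonface[OF c] by (auto simp: link_map_def fun_eq_iff indep_face_def)
  moreover have "c \<in> chains K V E k" using c by (auto simp: chains_def indep_face_def)
  ultimately show "c \<in> {c \<in> chains K V E k. link_map v c = 0}" by simp
qed

text \<open>Together with the kernel and the image of \<open>link_map v\<close> this gives a short
  exact sequence of complexes: G - v, then G, then G - N[v] shifted by one.\<close>

lemma link_map_boundary:
  assumes E: "\<forall>e\<in>E. card e = 2" and v: "v \<in> V" and V: "finite V" and c: "c \<in> chains K V E k"
  shows "link_map v (boundary V c) = boundary (outside E V v) (link_map v c)"
proof
  fix \<tau>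
  let ?V' = "outside E V v"
  show "link_map v (boundary V c) \<tau> = boundary ?V' (link_map v c) \<tau>"
  proof (cases "v \<in> \<tau>")
    case True
    then show ?thesis by (simp add: link_map_def boundary_def)
  next
    case False
    show ?thesis
    proof (cases "finite \<tau>")
      case fin: True
      let ?s = "\<lambda>\<sigma>. (-1) ^ card {u\<in>\<sigma>. v < u} :: 'b"
      \<comment> \<open>If \<open>v < w\<close>, inserting \<open>v\<close> raises the position of
        \<open>w\<close> by one and inserting \<open>w\<close> raises the number of elements above
        \<open>v\<close> by one; otherwise neither changes.\<close>
      have sgn: "?s \<tau> * (-1) ^ card {u \<in> insert v \<tau>. u < w} = (-1) ^ card {u\<in>\<tau>. u < w} * ?s (insert w \<tau>)"
        if "w \<notin> \<tau>" "w \<noteq> v" for w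
      proof (cases "v < w")
        case True
        then have "{u \<in> insert v \<tau>. u < w} = insert v {u\<in>\<tau>. u < w}"
          "{u \<in> insert w \<tau>. v < u} = insert w {u\<in>\<tau>. v < u}" by auto
        then show ?thesis using fin False that by simp
      next
        case f: False
        then have "{u \<in> insert v \<tau>. u < w} = {u\<in>\<tau>. u < w}"
          "{u \<in> insert w \<tau>. v < u} = {u\<in>\<tau>. v < u}" by auto
        then show ?thesis by simp
      qed
      have "link_map v (boundary V c) \<tau>
          = (\<Sum>w\<in>V - insert v \<tau>. ?s \<tau> * (-1) ^ card {u \<in> insert v \<tau>. u < w} * c (insert w (insert v \<tau>)))"
        using False by (simp add: link_map_def boundary_def sum_distrib_left mult.assoc)
      also have "\<dots> = (\<Sum>w\<in>V - insert v \<tau>. (-1) ^ card {u\<in>\<tau>. u < w} * link_map v c (insert w \<tau>))"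
      proof (intro sum.cong refl)
        fix w assume w: "w \<in> V - insert v \<tau>"
        then have "link_map v c (insert w \<tau>) = ?s (insert w \<tau>) * c (insert w (insert v \<tau>))"
          using False by (auto simp: link_map_def insert_commute)
        then show "?s \<tau> * (-1) ^ card {u \<in> insert v \<tau>. u < w} * c (insert w (insert v \<tau>))
            = (-1) ^ card {u\<in>\<tau>. u < w} * link_map v c (insert w \<tau>)"
          using sgn[of w] w by (simp only: mult.assoc[symmetric]) auto
      qed
      also have "\<dots> = boundary ?V' (link_map v c) \<tau>"
        unfolding boundary_def
      \<comment> \<open>The dropped \<open>w\<close> are neighbours of \<open>v\<close>, so no face
        contains both.\<close>
      proof (intro sum.mono_neutral_right ballI)
        fix w assume w: "w \<in> V - insert v \<tau> - (?V' - \<tau>)"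
        then have "\<not> indep_face V E (insert v (insert w \<tau>))"
          using False by (subst indep_face_insert[OF E v]) (auto simp: indep_face_def)
        then show "(-1) ^ card {u\<in>\<tau>. u < w} * link_map v c (insert w \<tau>) = 0"
          using chains_nonface[OF c] by (simp add: link_map_def)
      qed (use V in auto)
      finally show ?thesis .
    next
      \<comment> \<open>The signs may be meaningless here, since \<open>card\<close> of an infinite
        set is 0; but faces are finite, so both sides vanish.\<close>
      case inf: False
      have z: "c (insert x (insert y \<tau>)) = 0" for x y
        using inf V by (intro chains_nonface[OF c]) (auto simp: indep_face_def dest: finite_subset)
      then show ?thesis using False
        by (auto simp: link_map_def boundary_def intro!: sum.neutral)
    qed
  qed
qed

section \<open>Ranks and Betti numbers under deletion and link\<close>

lemma rank_deletion_link:
  assumes E: "\<forall>e\<in>E. card e = 2" and v: "v \<in> V" and V: "finite V"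
  shows "vdim (boundary (V - {v}) ` chains K (V - {v}) E (Suc k))
      + vdim (boundary (outside E V v) ` chains K (outside E V v) E k)
    \<le> vdim (boundary V ` chains K V E (Suc k))"
proof -
  let ?B = "boundary V ` chains K V E (Suc k)"
  \<comment> \<open>Boundaries of the deletion lie in the kernel of \<open>link_map v\<close>, which
    maps the boundaries of G onto those of the link. Rank-nullity on the space of boundaries then
    adds the two ranks.\<close>
  have "boundary (V - {v}) ` chains K (V - {v}) E (Suc k) \<subseteq> {w \<in> ?B. link_map v w = 0}"
  proof safe
    fix c assume c: "c \<in> chains K (V - {v}) E (Suc k)"
    have c': "c \<in> chains K V E (Suc k)" "link_map v c = 0" using c link_map_kernel[OF v V] by blast+
    have bc: "boundary (V - {v}) c = boundary V c" using boundary_subset[OF V _ c] by auto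
    show "boundary (V - {v}) c \<in> ?B" using c' bc by auto
    show "link_map v (boundary (V - {v}) c) = 0"
      unfolding bc link_map_boundary[OF E v V c'(1)] c'(2) by (simp add: boundary_def fun_eq_iff)
  qed
  then have 1: "vdim (boundary (V - {v}) ` chains K (V - {v}) E (Suc k)) \<le> vdim {w \<in> ?B. link_map v w = 0}"
    using boundary_supp[of V K E "Suc k"] V by (intro vdim_mono[of "Pow V"]) auto
  have "link_map v ` ?B = boundary (outside E V v) ` link_map v ` chains K V E (Suc k)"
    using link_map_boundary[OF E v V] by (force simp: image_image)
  then have "link_map v ` ?B = boundary (outside E V v) ` chains K (outside E V v) E k"
    by (simp add: link_map_chains[OF E v V])
  then show ?thesis
    using 1 vdim_rank_nullity[OF finite_Pow_iff[THEN iffD2, OF V] boundary_supp subspace_boundary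
        linear_link_map, of K E "Suc k" v]
    by simp
qed

lemma dim_deletion_link:
  fixes V :: "'a::linorder set"
  assumes E: "\<forall>e\<in>E. card e = 2" and v: "v \<in> V" and V: "finite V"
  shows "vdim (chains K V E (Suc k)) = vdim (chains K (V - {v}) E (Suc k)) + vdim (chains K (outside E V v) E k)"
  using vdim_rank_nullity[OF finite_Pow_iff[THEN iffD2, OF V] chains_supp subspace_chains
      linear_link_map, of K E "Suc k" v]
  by (simp add: link_map_chains[OF E v V] link_map_kernel[OF v V])

lemma face_card_0: "indep_face V E \<sigma> \<Longrightarrow> card \<sigma> = 0 \<Longrightarrow> finite V \<Longrightarrow> \<sigma> = {}"
  by (metis card_0_eq finite_subset indep_face_def)

lemma chains_0: "chains K V E 0 = chains K {} E 0" if "finite V"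
proof -
  have "indep_face V E \<sigma> \<and> card \<sigma> = 0 \<longleftrightarrow> indep_face {} E \<sigma> \<and> card \<sigma> = 0" for \<sigma>
    using face_card_0[of V E \<sigma>] that by (auto simp: indep_face_def)
  then show ?thesis by (simp add: chains_def)
qed

lemma boundary_chains_0: "boundary V ` chains K V E 0 = {0}" if "finite V"
proof -
  have "boundary V c = 0" if c: "c \<in> chains K V E 0" for c
  proof -
    have "c \<sigma> = 0" if "\<sigma> \<noteq> {}" for \<sigma>
      using c that \<open>finite V\<close> face_card_0[of V E \<sigma>] by (auto simp: chains_def)
    then show ?thesis by (simp add: boundary_def fun_eq_iff)
  qed
  moreover have "0 \<in> chains K V E 0" by (simp add: chains_def)
  ultimately show ?thesis by force
qed

text \<open>A Betti number is a chain dimension minus two ranks; dimensions add and ranks are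
  superadditive. Truncated subtraction on the right can only enlarge the bound. Faces without
  vertices have no counterpart in the link, hence the separate second inequality.\<close>

lemma red_betti_deletion_link:
  assumes E: "\<forall>e\<in>E. card e = 2" and v: "v \<in> V" and V: "finite V"
  shows "red_betti K V E (Suc k) \<le> red_betti K (V - {v}) E (Suc k) + red_betti K (outside E V v) E k"
    and "red_betti K V E 0 \<le> red_betti K (V - {v}) E 0"
proof -
  have fin: "finite (V - {v})" "finite (outside E V v)" using V by auto
  show "red_betti K V E (Suc k) \<le> red_betti K (V - {v}) E (Suc k) + red_betti K (outside E V v) E k"
    using rank_deletion_link[OF E v V, of K k] rank_deletion_link[OF E v V, of K "Suc k"]
      dim_deletion_link[OF E v V, of K k] chains_rank_nullity[OF V, of K E "Suc k"]
      chains_rank_nullity[OF fin(1), of K E "Suc k"] chains_rank_nullity[OF fin(2), of K E k]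
    unfolding red_betti_def by linarith
  show "red_betti K V E 0 \<le> red_betti K (V - {v}) E 0"
    using rank_deletion_link[OF E v V, of K 0] chains_rank_nullity[OF V, of K E 0]
      chains_rank_nullity[OF fin(1), of K E 0] chains_0[OF V, of K E] chains_0[OF fin(1), of K E]
      boundary_chains_0[OF V, of K E] boundary_chains_0[OF fin(1), of K E]
    unfolding red_betti_def by simp
qed

lemma red_betti_large:
  fixes V :: "'a::linorder set"
  assumes "finite V" "card V < k"
  shows "red_betti K V E k = 0"
proof -
  have "\<not> (indep_face V E \<sigma> \<and> card \<sigma> = k)" for \<sigma>
    using assms card_mono[of V \<sigma>] by (auto simp: indep_face_def)
  then have "chains K V E k \<subseteq> supp_on {}" by (auto simp: chains_def supp_on_def)
  then have "vdim {c \<in> chains K V E k. boundary V c = (\<lambda>_. 0)} \<le> card ({} :: 'a set set)"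
    by (intro vdim_le_card) auto
  then show ?thesis by (simp add: red_betti_def)
qed

text \<open>Lets the sums for a graph and for its subgraphs run over a common range.\<close>

lemma btilde_eq_sum:
  assumes "finite V" "card V \<le> n"
  shows "btilde K V E = (\<Sum>k\<le>n. red_betti K V E k)"
  unfolding btilde_def using assms by (intro sum.mono_neutral_left) (auto simp: red_betti_large)

theorem btilde_deletion_link:
  assumes E: "\<forall>e\<in>E. card e = 2" and v: "v \<in> V" and V: "finite V"
  shows "btilde K V E \<le> btilde K (V - {v}) E + btilde K (outside E V v) E"
proof -
  let ?n = "card V"
  have le: "card (V - {v}) \<le> Suc ?n" "card (outside E V v) \<le> ?n" "?n \<le> Suc ?n"
    using V card_mono[OF V, of "V - {v}"] card_mono[OF V, of "outside E V v"] by auto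
  have "btilde K V E = red_betti K V E 0 + (\<Sum>k\<le>?n. red_betti K V E (Suc k))"
    using V by (simp add: btilde_eq_sum[OF _ le(3)] sum.atMost_Suc_shift del: sum.atMost_Suc)
  also have "\<dots> \<le> red_betti K (V - {v}) E 0 +
      (\<Sum>k\<le>?n. red_betti K (V - {v}) E (Suc k) + red_betti K (outside E V v) E k)"
    by (intro add_mono sum_mono red_betti_deletion_link[OF E v V])
  also have "\<dots> = btilde K (V - {v}) E + btilde K (outside E V v) E"
    using V by (simp add: btilde_eq_sum[OF _ le(1)] btilde_eq_sum[OF _ le(2)] sum.distrib
        sum.atMost_Suc_shift del: sum.atMost_Suc)
  finally show ?thesis .
qed

section \<open>Cones: vanishing for an isolated vertex\<close>

lemma vdim_image_le:
  assumes "finite X" "W \<subseteq> supp_on X" "fs.subspace W" "Vector_Spaces.linear fscale fscale T"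
  shows "vdim (T ` W) \<le> vdim W"
  using vdim_rank_nullity[OF assms] by simp

text \<open>The complex is a cone with apex \<open>v\<close>: the part avoiding \<open>v\<close> of
  the boundary of the cone \<open>h\<close> over a chain \<open>a\<close> is \<open>a\<close> again,
  so \<open>\<rho>\<close> maps the boundaries onto a space containing all chains of G - v.\<close>

lemma cone_rank:
  assumes E: "\<forall>e\<in>E. card e = 2" and v: "v \<in> V" and V: "finite V" and iso: "\<And>u. u \<in> V \<Longrightarrow> \<not> adj E v u"
  shows "vdim (chains K (V - {v}) E k) \<le> vdim (boundary V ` chains K V E (Suc k))"
proof -
  define \<rho> :: "('a set \<Rightarrow> 'b) \<Rightarrow> _" where "\<rho> c = (\<lambda>\<sigma>. if v \<in> \<sigma> then 0 else c \<sigma>)" for c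
  have out: "outside E V v = V - {v}" using iso by auto
  have lin: "Vector_Spaces.linear fscale fscale \<rho>"
    unfolding Vector_Spaces.linear_iff
    by (auto simp: fs.vector_space_axioms \<rho>_def fun_eq_iff algebra_simps)
  have "chains K (V - {v}) E k \<subseteq> \<rho> ` boundary V ` chains K V E (Suc k)"
  proof
    fix a assume a: "a \<in> chains K (V - {v}) E k"
    define h where "h \<sigma> = (if v \<in> \<sigma> then (-1) ^ card {u \<in> \<sigma>. u < v} * a (\<sigma> - {v}) else 0)" for \<sigma>
    have "h \<in> chains K V E (Suc k)"
    proof (rule chainsI)
      fix \<sigma> assume "h \<sigma> \<noteq> 0"
      then have *: "v \<in> \<sigma>" "a (\<sigma> - {v}) \<noteq> 0" by (auto simp: h_def split: if_splits)
      then have f: "indep_face (outside E V v) E (\<sigma> - {v})" "card (\<sigma> - {v}) = k"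
        using a unfolding out by (auto simp: chains_def)
      then have "finite \<sigma>" using V by (auto simp: indep_face_def dest: finite_subset)
      then have "card \<sigma> = Suc k" using f(2) card.remove[OF _ *(1)] by simp
      then show "indep_face V E \<sigma> \<and> card \<sigma> = Suc k"
        using f(1) *(1) indep_face_insert[OF E v, of "\<sigma> - {v}"] by (simp add: insert_absorb)
    qed
    moreover have "\<rho> (boundary V h) = a"
    proof
      fix \<tau>
      show "\<rho> (boundary V h) \<tau> = a \<tau>"
      proof (cases "v \<in> \<tau>")
        case True
        then have "a \<tau> = 0" by (intro chains_nonface[OF a]) (auto simp: indep_face_def)
        with True show ?thesis by (simp add: \<rho>_def)
      next
        case False
        have eq: "{u \<in> insert v \<tau>. u < v} = {u \<in> \<tau>. u < v}" by auto
        have hv: "h (insert v \<tau>) = (-1) ^ card {u \<in> \<tau>. u < v} * a \<tau>"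
          unfolding h_def eq using False by simp
        have "boundary V h \<tau> = (\<Sum>w\<in>{v}. (-1) ^ card {u\<in>\<tau>. u < w} * h (insert w \<tau>))"
          unfolding boundary_def using v V False
          by (intro sum.mono_neutral_right) (auto simp: h_def)
        also have "\<dots> = a \<tau>" by (simp add: hv minus_one_power_cancel)
        finally show ?thesis using False by (simp add: \<rho>_def)
      qed
    qed
    ultimately show "a \<in> \<rho> ` boundary V ` chains K V E (Suc k)" by blast
  qed
  moreover have "\<rho> ` boundary V ` chains K V E (Suc k) \<subseteq> supp_on (Pow V)"
    using boundary_supp[of V K E "Suc k"] by (fastforce simp: supp_on_def \<rho>_def split: if_splits)
  ultimately have "vdim (chains K (V - {v}) E k) \<le> vdim (\<rho> ` boundary V ` chains K V E (Suc k))"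
    using V by (intro vdim_mono[of "Pow V"]) auto
  also have "\<dots> \<le> vdim (boundary V ` chains K V E (Suc k))"
    using V by (intro vdim_image_le[OF _ boundary_supp subspace_boundary lin]) auto
  finally show ?thesis .
qed

text \<open>The chain space splits into two chain spaces of G - v. By \<open>cone_rank\<close> their
  dimensions are at most the ranks of the boundary maps into and out of this degree, so nothing is
  left for homology.\<close>

theorem btilde_isolated:
  assumes E: "\<forall>e\<in>E. card e = 2" and v: "v \<in> V" and V: "finite V" and iso: "\<And>u. u \<in> V \<Longrightarrow> \<not> adj E v u"
  shows "btilde K V E = 0"
proof -
  have out: "outside E V v = V - {v}" using iso by auto
  have fin: "finite (V - {v})" using V by auto
  have "red_betti K V E k = 0" for k
  proof (cases k)
    case 0
    then show ?thesis
      using cone_rank[OF E v V iso, of K 0] chains_rank_nullity[OF V, of K E 0]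
        chains_0[OF V, of K E] chains_0[OF fin, of K E]
      unfolding red_betti_def by simp
  next
    case (Suc j)
    then show ?thesis
      using cone_rank[OF E v V iso, of K k] cone_rank[OF E v V iso, of K j]
        chains_rank_nullity[OF V, of K E k] dim_deletion_link[OF E v V, of K j]
      unfolding red_betti_def out by simp
  qed
  then show ?thesis by (simp add: btilde_def)
qed

theorem btilde_empty: "btilde K ({} :: 'a::linorder set) E \<le> 1"
proof -
  have "chains K {} E 0 \<subseteq> supp_on {{}}" by (auto simp: chains_def supp_on_def indep_face_def)
  then have "vdim {c \<in> chains K {} E 0. boundary {} c = (\<lambda>_. 0)} \<le> card {{} :: 'a set}"
    by (intro vdim_le_card) auto
  then show ?thesis by (simp add: btilde_def red_betti_def)
qed

section \<open>The extremal argument\<close>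

definition cbrt2 :: real where "cbrt2 = 2 powr (1/3)"

definition icbrt2 :: real where "icbrt2 = inverse cbrt2"

lemma cbrt2_ge_1: "1 \<le> cbrt2"
  by (simp add: cbrt2_def ge_one_powr_ge_zero)

lemma cbrt2_cube: "cbrt2 ^ 3 = 2"
  by (simp add: cbrt2_def powr_powr flip: powr_realpow)

lemma icbrt2_pos: "0 < icbrt2"
  using cbrt2_ge_1 by (simp add: icbrt2_def)

lemma icbrt2_cube: "icbrt2 ^ 3 = 1/2"
  by (simp add: icbrt2_def power_inverse cbrt2_cube)

lemma icbrt2_powers:
  "icbrt2 ^ 4 = icbrt2 / 2" "icbrt2 ^ 5 = icbrt2\<^sup>2 / 2" "icbrt2 ^ 6 = 1/4" "icbrt2 ^ 7 = icbrt2 / 4"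
  "icbrt2 ^ 8 = icbrt2\<^sup>2 / 4" "icbrt2 ^ 9 = 1/8" "icbrt2 ^ 10 = icbrt2 / 8" "icbrt2 ^ 11 = icbrt2\<^sup>2 / 8"
  "icbrt2 ^ 12 = 1/16"
proof -
  have e: "(4::nat) = 3 + 1" "(5::nat) = 3 + 2" "(6::nat) = 3 * 2" "(7::nat) = 3 * 2 + 1" "(8::nat) = 3 * 2 + 2"
    "(9::nat) = 3 * 3" "(10::nat) = 3 * 3 + 1" "(11::nat) = 3 * 3 + 2" "(12::nat) = 3 * 4" by simp_all
  show "icbrt2 ^ 4 = icbrt2 / 2" "icbrt2 ^ 5 = icbrt2\<^sup>2 / 2" "icbrt2 ^ 6 = 1/4" "icbrt2 ^ 7 = icbrt2 / 4"
    "icbrt2 ^ 8 = icbrt2\<^sup>2 / 4" "icbrt2 ^ 9 = 1/8" "icbrt2 ^ 10 = icbrt2 / 8" "icbrt2 ^ 11 = icbrt2\<^sup>2 / 8"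
    "icbrt2 ^ 12 = 1/16"
    by (simp_all only: e power_add power_mult icbrt2_cube) (simp_all add: power_divide)
qed

text \<open>Once powers are reduced by the cube, the comparisons below are linear in
  \<open>icbrt2\<close> and its square, whose values are about 0.7937 and 0.6300. The tight ones,
  such as \<open>icbrt2 + icbrt2 ^ 7 \<le> 1\<close>, amount to
  \<open>icbrt2 \<le> 4/5\<close>.\<close>

lemma icbrt2_bounds: "icbrt2 \<le> 397/500" "79/100 \<le> icbrt2" "icbrt2\<^sup>2 \<le> 63/100" "62/100 \<le> icbrt2\<^sup>2"
proof -
  have mono: "x \<le> y" if "x ^ 3 \<le> y ^ 3" "0 \<le> y" for x y :: real
    using that power_le_imp_le_base[of x 2 y] by (simp add: eval_nat_numeral)
  have sq: "(icbrt2\<^sup>2) ^ 3 = 1/4"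
    using icbrt2_powers(3) by (simp flip: power_mult)
  show "icbrt2 \<le> 397/500"
    by (rule mono) (simp_all only: icbrt2_cube, simp_all add: power_divide)
  show "79/100 \<le> icbrt2"
    by (rule mono) (simp_all only: icbrt2_cube, use icbrt2_pos in \<open>simp_all add: power_divide\<close>)
  show "icbrt2\<^sup>2 \<le> 63/100"
    by (rule mono) (simp_all only: sq, simp_all add: power_divide)
  show "62/100 \<le> icbrt2\<^sup>2"
    by (rule mono) (simp_all only: sq, simp_all add: power_divide)
qed

lemmas icbrt2_arith = icbrt2_cube icbrt2_powers icbrt2_bounds

text \<open>Isolates the three properties of \<open>btilde\<close> that the combinatorial argument
  uses. \<open>b\<close> depends on a vertex set only, since all graphs that occur are induced
  subgraphs of one fixed graph.\<close>

locale K4_free_subadditive =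
  fixes R :: "'a \<Rightarrow> 'a \<Rightarrow> bool" (infix "\<sim>" 50) and b :: "'a set \<Rightarrow> real"
  assumes sym: "x \<sim> y \<Longrightarrow> y \<sim> x" and irrefl: "\<not> x \<sim> x"
    and K4: "w \<sim> x \<Longrightarrow> w \<sim> y \<Longrightarrow> w \<sim> z \<Longrightarrow> x \<sim> y \<Longrightarrow> x \<sim> z \<Longrightarrow> y \<sim> z \<Longrightarrow> False"
    and deletion: "finite W \<Longrightarrow> v \<in> W \<Longrightarrow> b W \<le> b (W - {v}) + b (W - insert v {y. v \<sim> y})"
    and isolated: "finite W \<Longrightarrow> v \<in> W \<Longrightarrow> (\<And>y. y \<in> W \<Longrightarrow> \<not> v \<sim> y) \<Longrightarrow> b W = 0"
    and empty: "b {} \<le> 1"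
begin

lemma sym_iff: "x \<sim> y \<longleftrightarrow> y \<sim> x"
  using sym by blast

definition N :: "'a set \<Rightarrow> 'a \<Rightarrow> 'a set" where "N W v = {y \<in> W. v \<sim> y}"

abbreviation dg :: "'a set \<Rightarrow> 'a \<Rightarrow> nat" where "dg W v \<equiv> card (N W v)"

definition D :: "'a set \<Rightarrow> 'a \<Rightarrow> 'a set" where "D W x = W - insert x {y. x \<sim> y}"

definition bd :: "real \<Rightarrow> 'a set \<Rightarrow> bool" where "bd s W \<longleftrightarrow> b W \<le> s * cbrt2 ^ card W"

text \<open>Normalised so that the bound to be proved for \<open>W\<close> reads \<open>nb W W \<le> 1\<close>.\<close>
definition nb :: "'a set \<Rightarrow> 'a set \<Rightarrow> real" where "nb W W' = b W' / cbrt2 ^ card W"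

text \<open>The induction hypothesis without the bound for \<open>W\<close> itself: it holds for a
  minimal counterexample and passes to all subsets.\<close>

definition hereditary :: "'a set \<Rightarrow> bool" where "hereditary W \<longleftrightarrow> finite W \<and> (\<forall>W'. W' \<subset> W \<longrightarrow> bd 1 W')"

text \<open>Encoded by neighbourhoods inside \<open>W\<close>, because the later use is precisely
  that the triangle has no further neighbours in \<open>W\<close>.\<close>

definition tri :: "'a set \<Rightarrow> 'a \<Rightarrow> bool" where
  "tri W z \<longleftrightarrow> (\<exists>x y. N W z = {x, y} \<and> N W x = {z, y} \<and> N W y = {z, x})"

lemma mem_N: "y \<in> N W v \<longleftrightarrow> y \<in> W \<and> v \<sim> y" by (simp add: N_def)

lemma mem_D: "y \<in> D W x \<longleftrightarrow> y \<in> W \<and> y \<noteq> x \<and> \<not> x \<sim> y" by (auto simp: D_def)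

lemma bd_iff_nb: "bd s W \<longleftrightarrow> nb W W \<le> s"
  using cbrt2_ge_1 by (simp add: bd_def nb_def field_simps)

lemma hereditary_finite: "hereditary W \<Longrightarrow> finite W" by (simp add: hereditary_def)

lemma hereditary_subset: "hereditary W \<Longrightarrow> W' \<subseteq> W \<Longrightarrow> hereditary W'"
  by (auto simp: hereditary_def intro: finite_subset)

lemma finite_N: "hereditary W \<Longrightarrow> finite (N W v)"
  by (auto simp: N_def dest: hereditary_finite)

lemma bd_mono: "bd s W \<Longrightarrow> s \<le> s' \<Longrightarrow> bd s' W"
  by (simp add: bd_iff_nb)

lemma dg_pos: "hereditary W \<Longrightarrow> y \<in> N W x \<Longrightarrow> 1 \<le> dg W x"
  using finite_N[of W x] card_gt_0_iff[of "N W x"] by auto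

section \<open>Branching along a list of deleted vertices\<close>

lemma nb_le:
  assumes "finite W" "bd s W'" "0 \<le> s" "card W' + k \<le> card W"
  shows "nb W W' \<le> s * icbrt2 ^ k"
proof -
  have "b W' \<le> s * cbrt2 ^ card W'" using assms by (simp add: bd_def)
  also have "\<dots> \<le> s * cbrt2 ^ (card W - k)"
    using assms cbrt2_ge_1 by (intro mult_left_mono power_increasing) auto
  also have "cbrt2 ^ (card W - k) = cbrt2 ^ card W / cbrt2 ^ k"
    using assms cbrt2_ge_1 by (intro power_diff) auto
  finally show ?thesis
    using cbrt2_ge_1 by (simp add: nb_def icbrt2_def power_inverse field_simps)
qed

text \<open>The branch has lost N[x] and the earlier deleted vertices outside it. \<open>k\<close>
  only bounds this loss from below, so lower bounds on degrees suffice.\<close>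

lemma term_le:
  assumes W: "hereditary W" and d: "distinct (x # xs)" and sub: "set (x # xs) \<subseteq> W"
    and bd: "bd s (D (W - set xs) x)" and s: "0 \<le> s"
    and k: "k \<le> Suc (dg W x + length (filter (\<lambda>y. \<not> x \<sim> y) xs))"
  shows "nb W (D (W - set xs) x) \<le> s * icbrt2 ^ k"
proof -
  have fin: "finite W" using W by (rule hereditary_finite)
  let ?X = "{y \<in> set xs. \<not> x \<sim> y}" and ?Y = "insert x (N W x)"
  have "card ?X = length (filter (\<lambda>y. \<not> x \<sim> y) xs)"
    using d distinct_card[of "filter (\<lambda>y. \<not> x \<sim> y) xs"] by simp
  moreover have "card ?Y = Suc (dg W x)"
    using finite_N[OF W] by (simp add: mem_N irrefl)
  moreover have "card (?X \<union> ?Y) = card ?X + card ?Y"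
    using d finite_N[OF W] by (intro card_Un_disjoint) (auto simp: mem_N)
  ultimately have c: "k \<le> card (?X \<union> ?Y)" using k by simp
  have "D (W - set xs) x = W - (?X \<union> ?Y)" by (auto simp: D_def N_def)
  moreover have "?X \<union> ?Y \<subseteq> W" using sub by (auto simp: mem_N)
  moreover have "card (W - Z) + card Z = card W" if "Z \<subseteq> W" for Z
    using that fin by (simp add: card_Diff_subset finite_subset card_mono)
  ultimately have "card (D (W - set xs) x) + card (?X \<union> ?Y) = card W" by metis
  then show ?thesis using nb_le[OF fin bd s, of k] c by simp
qed

lemma D_psubset: "x \<in> W \<Longrightarrow> D (W - S) x \<subset> W"
  by (auto simp: D_def)

lemma hereditary_D: "hereditary W \<Longrightarrow> hereditary (D (W - S) x)"
  by (erule hereditary_subset) (auto simp: D_def)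

lemma term_1:
  assumes "hereditary W" "distinct (x # xs)" "set (x # xs) \<subseteq> W"
    and "k \<le> Suc (dg W x + length (filter (\<lambda>y. \<not> x \<sim> y) xs))"
  shows "nb W (D (W - set xs) x) \<le> icbrt2 ^ k"
proof -
  have "bd 1 (D (W - set xs) x)" using assms D_psubset[of x W "set xs"] by (simp add: hereditary_def)
  from term_le[OF assms(1-3) this _ assms(4)] show ?thesis by simp
qed

text \<open>The head of the list is the vertex that is deleted last.\<close>
fun branches :: "'a set \<Rightarrow> 'a list \<Rightarrow> real" where
  "branches W [] = 0"
| "branches W (x # xs) = nb W (D (W - set xs) x) + branches W xs"

lemma branching:
  assumes "finite W" "distinct xs" "set xs \<subseteq> W"
  shows "nb W W \<le> nb W (W - set xs) + branches W xs"
  using assms(2,3)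
proof (induction xs)
  case (Cons x xs)
  have "b (W - set xs) \<le> b (W - set xs - {x}) + b (D (W - set xs) x)"
    unfolding D_def using assms(1) Cons.prems by (intro deletion) auto
  then have "nb W (W - set xs) \<le> nb W (W - set xs - {x}) + nb W (D (W - set xs) x)"
    using cbrt2_ge_1 by (simp add: nb_def divide_right_mono flip: add_divide_distrib)
  moreover have "W - set xs - {x} = W - set (x # xs)" by auto
  ultimately show ?case using Cons by simp
qed simp

lemma expand:
  assumes "hereditary W" "v \<in> W" "N W v = set xs" "distinct xs"
  shows "nb W W \<le> branches W xs"
proof -
  have "v \<notin> set xs" using assms(3) irrefl mem_N[of v W v] by auto
  moreover have "\<not> v \<sim> y" if "y \<in> W - set xs" for y
    using that mem_N[of y W v] assms(3) by blast
  ultimately have "b (W - set xs) = 0"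
    using assms(2) hereditary_finite[OF assms(1)] by (intro isolated[of _ v]) auto
  moreover have "set xs \<subseteq> W" using assms(3) by (auto simp: N_def)
  ultimately show ?thesis
    using branching[of W xs] assms(4) hereditary_finite[OF assms(1)] by (simp add: nb_def)
qed

section \<open>Neighbourhood bookkeeping and vertices of degree at most 2\<close>

lemma nbr:
  assumes "N W v = X" "x \<in> X"
  shows "x \<in> W" "v \<sim> x" "x \<sim> v" "x \<noteq> v"
proof -
  have "x \<in> N W v" using assms by simp
  then show "x \<in> W" "v \<sim> x" "x \<sim> v" "x \<noteq> v" using sym irrefl by (auto simp: mem_N)
qed

lemma dg_lost:
  assumes "hereditary W" "W' \<subseteq> W" "X \<subseteq> N W z" "X \<inter> W' = {}" "dg W z \<le> card X + j"
  shows "dg W' z \<le> j"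
proof -
  have "N W' z \<subseteq> N W z - X" using assms by (auto simp: mem_N)
  then have "dg W' z \<le> card (N W z - X)"
    using finite_N[OF assms(1)] by (intro card_mono) auto
  also have "\<dots> = dg W z - card X"
    using assms(3) finite_N[OF assms(1)] by (intro card_Diff_subset) (auto intro: finite_subset)
  finally show ?thesis using assms(5) by simp
qed

text \<open>The only branch, at the single neighbour of \<open>z\<close>, loses at least that
  neighbour and \<open>z\<close>.\<close>

lemma deg_le_1:
  assumes W: "hereditary W" "z \<in> W" "dg W z \<le> 1"
  shows "bd (icbrt2\<^sup>2) W"
proof (cases "dg W z = 0")
  case True
  then have "N W z = {}" using finite_N[OF W(1)] by simp
  then have "b W = 0" using W hereditary_finite by (intro isolated[of W z]) (auto simp: N_def)
  then show ?thesis using cbrt2_ge_1 by (simp add: bd_def)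
next
  case False
  then have "dg W z = 1" using W(3) by simp
  then obtain x where x: "N W z = {x}" using card_1_singletonE by blast
  note xs = nbr[OF x]
  have "1 \<le> dg W x" using W xs by (intro dg_pos[of _ z]) (auto simp: mem_N)
  then have "nb W (D W x) \<le> icbrt2 ^ 2" using term_1[of W x "[]" 2] W xs by simp
  moreover have "nb W W \<le> branches W [x]" using W x by (intro expand[of _ z]) auto
  ultimately show ?thesis by (simp add: bd_iff_nb)
qed

text \<open>Branch at the two neighbours of \<open>z\<close>. If they are nonadjacent, the second
  branch also loses the first neighbour; if adjacent, the excluded triangle component gives one of
  them a third neighbour, and that one is deleted first.\<close>

lemma deg_le_2:
  assumes W: "hereditary W" "z \<in> W" "dg W z \<le> 2" "\<not> tri W z"
  shows "bd (icbrt2 ^ 3 + icbrt2 ^ 4) W"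
proof (rule ccontr)
  assume neg: "\<not> ?thesis"
  have ge2: "2 \<le> dg W y" if "y \<in> W" for y
  proof (rule ccontr)
    assume "\<not> 2 \<le> dg W y"
    then have "bd (icbrt2\<^sup>2) W" using deg_le_1[OF W(1) that] by simp
    moreover have "icbrt2\<^sup>2 \<le> icbrt2 ^ 3 + icbrt2 ^ 4" using icbrt2_arith by linarith
    ultimately show False using neg bd_mono by blast
  qed
  have "dg W z = 2" using ge2[of z] W by simp
  then obtain x y where xy: "N W z = {x, y}" "x \<noteq> y" by (auto simp: card_2_iff)
  note x = nbr[OF xy(1), of x, simplified] and y = nbr[OF xy(1), of y, simplified]
  note ge = ge2[OF x(1)] ge2[OF y(1)]
  have ex: "nb W W \<le> branches W [y, x]" "nb W W \<le> branches W [x, y]"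
    using expand[OF W(1,2), of "[y, x]"] expand[OF W(1,2), of "[x, y]"] xy by auto
  show False
  proof (cases "x \<sim> y")
    case False
    have "nb W (D W x) \<le> icbrt2 ^ 3" using term_1[of W x "[]" 3] W x ge by simp
    moreover have "nb W (D (W - {x}) y) \<le> icbrt2 ^ 4"
      using term_1[of W y "[x]" 4] W x y xy ge False False[unfolded sym_iff[of x]] by auto
    ultimately show False using ex neg by (simp add: bd_iff_nb)
  next
    case True
    have "dg W x \<noteq> 2 \<or> dg W y \<noteq> 2"
    proof (rule ccontr)
      assume "\<not> ?thesis"
      moreover have "{z, y} \<subseteq> N W x" "{z, x} \<subseteq> N W y"
        using True sym x y W by (auto simp: mem_N)
      moreover have "card {z, y} = 2" "card {z, x} = 2" using x y by auto
      ultimately have "N W x = {z, y}" "N W y = {z, x}"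
        using card_subset_eq[OF finite_N[OF W(1)]] by metis+
      then show False using W(4) xy unfolding tri_def by blast
    qed
    then show False
    proof
      assume "dg W x \<noteq> 2"
      then have "nb W (D W x) \<le> icbrt2 ^ 4" using term_1[of W x "[]" 4] W x ge by simp
      moreover have "nb W (D (W - {x}) y) \<le> icbrt2 ^ 3"
        using term_1[of W y "[x]" 3] W x y xy ge by auto
      ultimately show False using ex neg by (simp add: bd_iff_nb)
    next
      assume "dg W y \<noteq> 2"
      then have "nb W (D W y) \<le> icbrt2 ^ 4" using term_1[of W y "[]" 4] W y ge by simp
      moreover have "nb W (D (W - {y}) x) \<le> icbrt2 ^ 3"
        using term_1[of W x "[y]" 3] W x y xy ge by auto
      ultimately show False using ex neg by (simp add: bd_iff_nb)
    qed
  qed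
qed

subsection \<open>Vertices of degree at most 3\<close>

lemma in_W_adj: "N W v = X \<Longrightarrow> x \<in> W \<Longrightarrow> v \<sim> x \<longleftrightarrow> x \<in> X"
  using mem_N by blast

lemma card_le_2: "A \<subseteq> {x, y} \<Longrightarrow> card A \<le> 2"
  using card_mono[of "{x, y}" A] by (cases "x = y") auto

lemma two_more:
  assumes "card S = card A + 2" "A \<subseteq> S" "finite S"
  obtains x y where "S = A \<union> {x, y}" "x \<noteq> y" "x \<notin> A" "y \<notin> A"
proof -
  have "card (S - A) = 2" using assms by (simp add: card_Diff_subset finite_subset)
  then obtain x y where "S - A = {x, y}" "x \<noteq> y" by (auto simp: card_2_iff)
  then show ?thesis using that[of x y] assms(2) by blast
qed

lemma not_tri_if_indep_nbrs:
  assumes "N W z \<subseteq> {x, y}" "\<not> x \<sim> y"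
  shows "\<not> tri W z"
proof
  assume "tri W z"
  then obtain p q where pq: "N W z = {p, q}" "N W p = {z, q}" unfolding tri_def by blast
  then have "p \<sim> q" by (auto simp: nbr)
  moreover have "p \<in> {x, y}" "q \<in> {x, y}" using pq assms by auto
  ultimately show False using assms(2) sym irrefl by blast
qed

lemma tri_deg: "tri W z \<Longrightarrow> y \<in> N W z \<Longrightarrow> dg W y \<le> 2"
  unfolding tri_def by (auto simp: card_insert_if)

definition \<alpha> :: real where "\<alpha> = icbrt2 ^ 4 + icbrt2 ^ 5 + icbrt2 ^ 6"

definition counterex_low :: "'a set \<Rightarrow> bool" where "counterex_low W \<longleftrightarrow> hereditary W \<and> \<not> bd \<alpha> W"

lemma counterex_low_expand:
  assumes "counterex_low W" "v \<in> W" "N W v = set xs" "distinct xs"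
  shows "icbrt2 ^ 4 + icbrt2 ^ 5 + icbrt2 ^ 6 < branches W xs"
  using expand[of W v xs] assms by (auto simp: counterex_low_def bd_iff_nb \<alpha>_def)

lemma counterex_low_deg_le_2:
  assumes "counterex_low W" "z \<in> W" "dg W z \<le> 2"
  shows "tri W z"
proof (rule ccontr)
  assume "\<not> tri W z"
  then have "bd (icbrt2 ^ 3 + icbrt2 ^ 4) W" using deg_le_2[of W z] assms by (simp add: counterex_low_def)
  moreover have "icbrt2 ^ 3 + icbrt2 ^ 4 \<le> \<alpha>" unfolding \<alpha>_def using icbrt2_arith by linarith
  ultimately show False using assms bd_mono by (auto simp: counterex_low_def)
qed

text \<open>A neighbour of degree at most 2 would lie in a triangle component, and then
  \<open>v\<close> would have degree at most 2.\<close>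

lemma counterex_low_deg_3_nbr:
  assumes W: "counterex_low W" "v \<in> W" "dg W v = 3" "x \<in> N W v"
  shows "3 \<le> dg W x"
proof (rule ccontr)
  assume "\<not> 3 \<le> dg W x"
  then have "tri W x" using W by (intro counterex_low_deg_le_2) (auto simp: mem_N)
  moreover have "v \<in> N W x" using W sym by (auto simp: mem_N)
  ultimately show False using tri_deg[of W x v] W by simp
qed

text \<open>Nonadjacency makes the three branches lose at least 4, 5 and 6 vertices, which is
  exactly \<open>\<alpha>\<close>.\<close>

lemma counterex_low_not_indep:
  assumes W: "counterex_low W" "v \<in> W" "N W v = {a, c, d}" "distinct [a, c, d]"
    and n: "\<not> a \<sim> c" "\<not> a \<sim> d" "\<not> c \<sim> d"
  shows False
proof -
  have g: "hereditary W" using W by (simp add: counterex_low_def)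
  have 3: "dg W v = 3" using W by simp
  note nb = nbr[OF W(3)] and ge = counterex_low_deg_3_nbr[OF W(1,2) 3, unfolded W(3)]
  note n' = n n[unfolded sym_iff[of a] sym_iff[of c d]]
  have "nb W (D W a) \<le> icbrt2 ^ 4"
    using term_1[of W a "[]" 4] g nb(1)[of a] ge[of a] by simp
  moreover have "nb W (D (W - {a}) c) \<le> icbrt2 ^ 5"
    using term_1[of W c "[a]" 5] g nb(1)[of a] nb(1)[of c] ge[of c] n' W(4) by auto
  moreover have "nb W (D (W - {c, a}) d) \<le> icbrt2 ^ 6"
    using term_1[of W d "[c, a]" 6] g nb(1)[of a] nb(1)[of c] nb(1)[of d] ge[of d] n' W(4) by auto
  moreover have "icbrt2 ^ 4 + icbrt2 ^ 5 + icbrt2 ^ 6 < branches W [d, c, a]"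
    using W by (intro counterex_low_expand[of W v]) auto
  ultimately show False by simp
qed

text \<open>Losing N[a] takes \<open>v\<close> and \<open>m\<close> from \<open>c\<close>, which
  keeps degree at most 1; the factor from \<open>deg_le_1\<close> turns the loss 4 at
  \<open>a\<close> into an effective 6.\<close>

lemma counterex_low_not_path_aux:
  assumes W: "counterex_low W" "v \<in> W" "N W v = {a, m, c}" "distinct [a, m, c]"
    and e: "a \<sim> m" "m \<sim> c" "\<not> a \<sim> c" and 3: "dg W c = 3"
  shows False
proof -
  have g: "hereditary W" using W by (simp add: counterex_low_def)
  have v3: "dg W v = 3" using W by simp
  note nb = nbr[OF W(3)] and ge = counterex_low_deg_3_nbr[OF W(1,2) v3, unfolded W(3)]
  note e' = e sym[OF e(1)] sym[OF e(2)] e(3)[unfolded sym_iff[of a]]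
  have "dg (D W a) c \<le> 1"
  proof (rule dg_lost[OF g, where X = "{v, m}"])
    show "{v, m} \<subseteq> N W c" using nb(3)[of c] nb(1)[of m] e' W(2) by (auto simp: mem_N)
    have "v \<noteq> m" using nb(4)[of m] by auto
    then show "dg W c \<le> card {v, m} + 1" using 3 by simp
    show "{v, m} \<inter> D W a = {}" using nb(3)[of a] e' by (auto simp: mem_D)
  qed (auto simp: D_def)
  then have "bd (icbrt2\<^sup>2) (D W a)"
    using g nb(1)[of c] W(4) e' hereditary_D[of W "{}" a] by (intro deg_le_1[of _ c]) (auto simp: mem_D)
  then have "nb W (D W a) \<le> icbrt2\<^sup>2 * icbrt2 ^ 4"
    using term_le[of W a "[]" "icbrt2\<^sup>2" 4] g nb(1)[of a] ge[of a] icbrt2_pos by simp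
  moreover have "nb W (D (W - {a}) m) \<le> icbrt2 ^ 4"
    using term_1[of W m "[a]" 4] g nb(1)[of a] nb(1)[of m] ge[of m] e' W(4) by auto
  moreover have "nb W (D (W - {m, a}) c) \<le> icbrt2 ^ 5"
    using term_1[of W c "[m, a]" 5] g nb(1)[of a] nb(1)[of c] nb(1)[of m] ge[of c] e' W(4) by auto
  moreover have "icbrt2 ^ 4 + icbrt2 ^ 5 + icbrt2 ^ 6 < branches W [c, m, a]"
    using W by (intro counterex_low_expand[of W v]) auto
  ultimately show False by (simp flip: power_add)
qed

text \<open>When both ends have degree at least 4, deleting the ends before the middle loses 5, 6
  and 4 vertices, again matching \<open>\<alpha>\<close>.\<close>

lemma counterex_low_not_path:
  assumes W: "counterex_low W" "v \<in> W" "N W v = {a, m, c}" "distinct [a, m, c]"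
    and e: "a \<sim> m" "m \<sim> c" "\<not> a \<sim> c"
  shows False
proof -
  have g: "hereditary W" using W by (simp add: counterex_low_def)
  have v3: "dg W v = 3" using W by simp
  note nb = nbr[OF W(3)] and ge = counterex_low_deg_3_nbr[OF W(1,2) v3, unfolded W(3)]
  note e' = e sym[OF e(1)] sym[OF e(2)] e(3)[unfolded sym_iff[of a]]
  have "dg W c \<noteq> 3" using counterex_low_not_path_aux[OF W e] by blast
  moreover have "dg W a \<noteq> 3"
    using counterex_low_not_path_aux[OF W(1,2), of c m a] W(3,4) e' by (auto simp: insert_commute)
  ultimately have 4: "4 \<le> dg W a" "4 \<le> dg W c" using ge[of a] ge[of c] by auto
  have "nb W (D W a) \<le> icbrt2 ^ 5"
    using term_1[of W a "[]" 5] g nb(1)[of a] 4 by simp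
  moreover have "nb W (D (W - {a}) c) \<le> icbrt2 ^ 6"
    using term_1[of W c "[a]" 6] g nb(1)[of a] nb(1)[of c] 4 e' W(4) by auto
  moreover have "nb W (D (W - {c, a}) m) \<le> icbrt2 ^ 4"
    using term_1[of W m "[c, a]" 4] g nb(1)[of a] nb(1)[of c] nb(1)[of m] ge[of m] W(4) by auto
  moreover have "icbrt2 ^ 4 + icbrt2 ^ 5 + icbrt2 ^ 6 < branches W [m, c, a]"
    using W by (intro counterex_low_expand[of W v]) auto
  ultimately show False by simp
qed

lemma counterex_low_one_edge:
  assumes W: "counterex_low W" "v \<in> W" "dg W v = 3" "x \<in> N W v" "y \<in> N W v" "x \<sim> y"
  obtains c where "N W v = {x, y, c}" "distinct [x, y, c]" "\<not> x \<sim> c" "\<not> y \<sim> c"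
proof -
  have "x \<noteq> y" using W irrefl by auto
  moreover have "card (N W v - {x, y}) = 1"
    using W \<open>x \<noteq> y\<close> by (simp add: card_Diff_subset)
  then obtain c where "N W v - {x, y} = {c}" using card_1_singletonE by blast
  ultimately have c: "N W v = {x, y, c}" "distinct [x, y, c]" using W by auto
  note nb = nbr[OF c(1)]
  have "\<not> x \<sim> c" "\<not> y \<sim> c"
    using counterex_low_not_path[OF W(1,2), of y x c] counterex_low_not_path[OF W(1,2), of x y c] K4[of v x y c]
      c nb W(6) sym[OF W(6)] by (auto simp: insert_commute)
  then show ?thesis using that c by blast
qed

text \<open>Deleting \<open>c\<close>, \<open>x\<close>, \<open>y\<close> in this order loses at
  least 4, 5 and 5 vertices, which is slightly too little; one more loss at any of them
  suffices.\<close>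

lemma counterex_low_one_edge_degrees:
  assumes W: "counterex_low W" "v \<in> W" "N W v = {x, y, c}" "distinct [x, y, c]"
    and e: "x \<sim> y" "\<not> x \<sim> c" "\<not> y \<sim> c"
  shows "dg W x = 3" "dg W y = 3" "dg W c = 3"
proof -
  have g: "hereditary W" using W by (simp add: counterex_low_def)
  have v3: "dg W v = 3" using W by simp
  note nb = nbr[OF W(3)] and ge = counterex_low_deg_3_nbr[OF W(1,2) v3, unfolded W(3)]
  have ex: "icbrt2 ^ 4 + icbrt2 ^ 5 + icbrt2 ^ 6 < branches W [y, x, c]"
    using W by (intro counterex_low_expand[of W v]) auto
  have c: "nb W (D W c) \<le> icbrt2 ^ k" if "k \<le> Suc (dg W c)" for k
    using term_1[of W c "[]" k] g nb(1)[of c] that by simp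
  have x: "nb W (D (W - {c}) x) \<le> icbrt2 ^ k" if "k \<le> Suc (Suc (dg W x))" for k
    using term_1[of W x "[c]" k] g nb(1)[of c] nb(1)[of x] that e W(4) by auto
  have y: "nb W (D (W - {x, c}) y) \<le> icbrt2 ^ k" if "k \<le> Suc (Suc (dg W y))" for k
    using term_1[of W y "[x, c]" k] g nb(1)[of c] nb(1)[of x] nb(1)[of y] that e sym[OF e(1)] W(4) by auto
  show "dg W x = 3"
  proof (rule ccontr)
    assume "dg W x \<noteq> 3"
    then show False using ex c[of 4] x[of 6] y[of 5] ge[of x] ge[of y] ge[of c] by simp
  qed
  show "dg W y = 3"
  proof (rule ccontr)
    assume "dg W y \<noteq> 3"
    then show False using ex c[of 4] x[of 5] y[of 6] ge[of x] ge[of y] ge[of c] by simp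
  qed
  show "dg W c = 3"
  proof (rule ccontr)
    assume "dg W c \<noteq> 3"
    then have "branches W [y, x, c] \<le> 3 * icbrt2 ^ 5"
      using c[of 5] x[of 5] y[of 5] ge[of x] ge[of y] ge[of c] by simp
    then show False using ex icbrt2_arith by linarith
  qed
qed

text \<open>If no shortcut applies, every degree-3 vertex near \<open>v\<close> lies in exactly one triangle, so the
  triangle attached to \<open>c\<close> survives the deletion of \<open>c\<close> and \<open>N[x]\<close> with a vertex of degree at most 2.\<close>
lemma counterex_low_deg_3:
  assumes W: "counterex_low W" "v \<in> W" "dg W v = 3"
  shows False
proof -
  have g: "hereditary W" using W by (simp add: counterex_low_def)
  obtain p q r where pqr: "N W v = {p, q, r}" "distinct [p, q, r]"
    using W(3) by (auto simp: card_3_iff)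
  have "p \<sim> q \<or> p \<sim> r \<or> q \<sim> r"
    using counterex_low_not_indep[OF W(1,2) pqr] by blast
  then obtain x y where xy: "x \<in> N W v" "y \<in> N W v" "x \<sim> y" using pqr by auto
  obtain c where c: "N W v = {x, y, c}" "distinct [x, y, c]" "\<not> x \<sim> c" "\<not> y \<sim> c"
    by (rule counterex_low_one_edge[OF W xy])
  note nb = nbr[OF c(1)]
  note dg = counterex_low_one_edge_degrees[OF W(1,2) c(1,2) xy(3) c(3,4)]
  have cW: "c \<in> W" and cv: "c \<sim> v" using nb[of c] by auto
  obtain p q where pq: "N W c = {v} \<union> {p, q}" "p \<noteq> q" "p \<notin> {v}" "q \<notin> {v}"
    using two_more[of "N W c" "{v}"] dg(3) cv W(2) finite_N[OF g] by (auto simp: mem_N)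
  have nc: "N W c = {v, p, q}" "distinct [v, p, q]" using pq by auto
  note nbc = nbr[OF nc(1)]
  have nv: "\<not> v \<sim> z" if "z \<in> {p, q}" for z
  proof
    assume "v \<sim> z"
    then have "z \<in> {x, y, c}" using c(1) nbc(1)[of z] that by (auto simp: in_W_adj[OF c(1)])
    then show False using that c(3,4) nbc[of z] sym irrefl by blast
  qed
  have pq': "p \<sim> q"
    using counterex_low_not_indep[OF W(1) cW nc] nv by auto
  have dpq: "dg W p = 3" "dg W q = 3"
    using counterex_low_one_edge_degrees[OF W(1) cW, of p q v] nc pq' nv sym_iff by (auto simp: insert_commute)
  \<comment> \<open>By \<open>counterex_low_one_edge\<close> at \<open>z\<close>, its third
    neighbour \<open>w'\<close> is not adjacent to \<open>z'\<close>. With \<open>c\<close> deleted,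
    \<open>z\<close> has at most these two nonadjacent neighbours, so it is in no triangle
    component.\<close>
  have beta: "bd (icbrt2 ^ 3 + icbrt2 ^ 4) (D (W - S) w)"
    if z: "z \<in> D (W - S) w" "z \<in> {p, q}" and S: "c \<in> S" for z w S
  proof -
    obtain z' where z': "{z, z'} = {p, q}" "z \<sim> z'" using z(2) pq' sym by blast
    have zW: "z \<in> W" "dg W z = 3" "z \<sim> c" "z' \<in> W" "c \<sim> z'"
      using z(2) z'(1) dpq nbc by (auto simp: doubleton_eq_iff)
    have "c \<in> N W z" "z' \<in> N W z" using zW cW z' by (auto simp: mem_N)
    then obtain w' where w': "N W z = {c, z', w'}" "\<not> z' \<sim> w'"
      using counterex_low_one_edge[OF W(1) zW(1,2), of c z'] zW(5) by metis
    have "N (D (W - S) w) z \<subseteq> {z', w'}"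
      using w'(1) S by (auto simp: N_def D_def)
    moreover from this have "dg (D (W - S) w) z \<le> 2"
      by (rule card_le_2)
    ultimately show ?thesis
      using deg_le_2[OF hereditary_D[OF g] z(1)] not_tri_if_indep_nbrs w'(2) by blast
  qed
  \<comment> \<open>Besides \<open>v\<close> and its partner in \<open>{x, y}\<close>, the vertex
    \<open>w\<close> has a single neighbour, so it cannot be adjacent to both \<open>p\<close> and
    \<open>q\<close>.\<close>
  have surv: "\<exists>z\<in>{p, q}. z \<in> D (W - S) w"
    if w: "w \<in> {x, y}" and S: "S \<subseteq> {c, x, y}" for w S
  proof -
    have wW: "w \<in> W" "dg W w = 3" "w \<sim> v" using w dg nb by auto
    have "\<exists>w'\<in>{x, y}. w \<sim> w'" using w xy(3) sym[OF xy(3)] by auto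
    then obtain w' where w': "w' \<in> {x, y}" "w \<sim> w'" by blast
    have w'W: "w' \<in> W" "w' \<noteq> v" "w' \<in> N W w" "v \<in> N W w"
      using nb[of w'] w' wW W(2) by (auto simp: mem_N)
    have "card (N W w - {v, w'}) = 1"
      using w'W wW(2) by (subst card_Diff_subset) auto
    then obtain w'' where "N W w - {v, w'} = {w''}" using card_1_singletonE by blast
    then have N: "N W w \<subseteq> {v, w', w''}" by auto
    have out: "z \<notin> {v, x, y, c}" "z \<in> W" if "z \<in> {p, q}" for z
    proof -
      have "x \<noteq> z" "y \<noteq> z" using nv[OF that] nb(2)[of x] nb(2)[of y] by auto
      moreover have "z \<noteq> c" "z \<in> W" "z \<noteq> v" using that nbc(4)[of z] nbc(1)[of z] pq(3,4) by auto
      ultimately show "z \<notin> {v, x, y, c}" "z \<in> W" by auto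
    qed
    have "z \<in> D (W - S) w" if "z \<in> {p, q}" "z \<noteq> w''" for z
    proof -
      have "\<not> w \<sim> z" using out[OF that(1)] that(2) N w'(1) mem_N by blast
      then show ?thesis using out[OF that(1)] S w by (auto simp: mem_D)
    qed
    then show ?thesis using pq(2) by blast
  qed
  have nn: "0 \<le> icbrt2 ^ 3 + icbrt2 ^ 4" using icbrt2_pos by simp
  have "nb W (D W c) \<le> icbrt2 ^ 4"
    using term_1[of W c "[]" 4] g cW dg by simp
  moreover have "nb W (D (W - {c}) x) \<le> (icbrt2 ^ 3 + icbrt2 ^ 4) * icbrt2 ^ 5"
    using term_le[of W x "[c]" _ 5, OF g _ _ _ nn] nb(1)[of c] nb(1)[of x] dg c surv[of x "{c}"] beta[of _ "{c}" x]
    by auto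
  moreover have "nb W (D (W - {x, c}) y) \<le> (icbrt2 ^ 3 + icbrt2 ^ 4) * icbrt2 ^ 5"
    using term_le[of W y "[x, c]" _ 5, OF g _ _ _ nn] nb(1)[of c] nb(1)[of x] nb(1)[of y] dg c
      surv[of y "{x, c}"] beta[of _ "{x, c}" y] by auto
  moreover have "icbrt2 ^ 4 + icbrt2 ^ 5 + icbrt2 ^ 6 < branches W [y, x, c]"
    using W c by (intro counterex_low_expand[of W v]) auto
  \<comment> \<open>As \<open>2 * icbrt2 ^ 3 = 1\<close>, two such branches weigh
    \<open>icbrt2 ^ 5 + icbrt2 ^ 6\<close>, so the total equals \<open>\<alpha>\<close>
    exactly.\<close>
  moreover have "(icbrt2 ^ 3 + icbrt2 ^ 4) * icbrt2 ^ 5 = icbrt2 ^ 8 + icbrt2 ^ 9"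
    by (simp add: algebra_simps flip: power_add)
  ultimately show False using icbrt2_arith by simp
qed

lemma deg_le_3:
  assumes "hereditary W" "v \<in> W" "dg W v \<le> 3" "\<not> tri W v"
  shows "bd \<alpha> W"
proof (rule ccontr)
  assume "\<not> bd \<alpha> W"
  then have s: "counterex_low W" using assms by (simp add: counterex_low_def)
  show False
    using counterex_low_deg_3[OF s assms(2)] counterex_low_deg_le_2[OF s assms(2)] assms(3,4)
    by (cases "dg W v = 3") auto
qed

section \<open>Residual degrees inside a branch\<close>

lemma bd_1_D: "hereditary W \<Longrightarrow> x \<in> W \<Longrightarrow> bd 1 (D (W - S) x)"
  using D_psubset[of x W S] by (simp add: hereditary_def)

lemmas bd_1_D_empty = bd_1_D[where S = "{}", simplified]

lemma dg_lost_D: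
  assumes g: "hereditary W" and X: "X \<subseteq> N W z"
    and lost: "\<And>x. x \<in> X \<Longrightarrow> x \<in> S \<or> w \<sim> x" and dg: "dg W z \<le> card X + j"
  shows "dg (D (W - S) w) z \<le> j"
proof (rule dg_lost[OF g _ X _ dg])
  show "D (W - S) w \<subseteq> W" by (auto simp: D_def)
  show "X \<inter> D (W - S) w = {}"
  proof (rule equals0I)
    fix x assume "x \<in> X \<inter> D (W - S) w"
    then show False using lost[of x] by (simp add: mem_D)
  qed
qed

lemma lost_1:
  assumes g: "hereditary W" and z: "z \<in> D (W - S) w" and X: "X \<subseteq> N W z"
    and lost: "\<And>x. x \<in> X \<Longrightarrow> x \<in> S \<or> w \<sim> x" and "dg W z \<le> card X + 1"
  shows "bd (icbrt2 ^ 2) (D (W - S) w)"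
proof (rule deg_le_1[OF hereditary_D[OF g] z])
  show "dg (D (W - S) w) z \<le> 1" by (rule dg_lost_D[OF g X]) (fact lost, fact)
qed

lemma lost_2:
  assumes g: "hereditary W" and z: "z \<in> D (W - S) w" and X: "X \<subseteq> N W z"
    and lost: "\<And>x. x \<in> X \<Longrightarrow> x \<in> S \<or> w \<sim> x" and "dg W z \<le> card X + 2"
    and "\<not> tri (D (W - S) w) z"
  shows "bd (icbrt2 ^ 3 + icbrt2 ^ 4) (D (W - S) w)"
proof (rule deg_le_2[OF hereditary_D[OF g] z])
  show "dg (D (W - S) w) z \<le> 2" by (rule dg_lost_D[OF g X]) (fact lost, fact)
qed fact

lemma lost_3:
  assumes g: "hereditary W" and z: "z \<in> D (W - S) w" and X: "X \<subseteq> N W z"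
    and lost: "\<And>x. x \<in> X \<Longrightarrow> x \<in> S \<or> w \<sim> x" and "dg W z \<le> card X + 3"
    and "\<not> tri (D (W - S) w) z"
  shows "bd (icbrt2 ^ 4 + icbrt2 ^ 5 + icbrt2 ^ 6) (D (W - S) w)"
  unfolding \<alpha>_def[symmetric]
proof (rule deg_le_3[OF hereditary_D[OF g] z])
  show "dg (D (W - S) w) z \<le> 3" by (rule dg_lost_D[OF g X]) (fact lost, fact)
qed fact

text \<open>For the case that \<open>lost_2\<close> leaves open. A triangle component is closed, so
  all further neighbours of \<open>p\<close> and \<open>q\<close> lie in the deleted set; this is
  the source of the structure in the cases below.\<close>

lemma triE:
  assumes g: "hereditary W" and t: "tri (D (W - S) w) z" and X: "X \<subseteq> N W z"
    and lost: "\<And>x. x \<in> X \<Longrightarrow> x \<in> S \<or> w \<sim> x" and dg: "dg W z = card X + 2"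
  obtains p q where "N W z = X \<union> {p, q}" "p \<sim> q" "p \<in> D (W - S) w" "q \<in> D (W - S) w"
    "N W p \<subseteq> {z, q, w} \<union> S \<union> N W w" "N W q \<subseteq> {z, p, w} \<union> S \<union> N W w"
proof -
  let ?D = "D (W - S) w"
  obtain p q where pq: "N ?D z = {p, q}" "N ?D p = {z, q}" "N ?D q = {z, p}"
    using t unfolding tri_def by blast
  have adj: "p \<sim> q" "p \<in> ?D" "q \<in> ?D" "p \<noteq> q"
    using nbr[OF pq(2), of q] nbr[OF pq(1), of p] by auto
  have sub: "{p, q} \<subseteq> N W z - X"
  proof -
    have "{p, q} \<subseteq> N W z" using pq(1) by (auto simp: N_def D_def)
    moreover have "x \<notin> ?D" if "x \<in> X" for x using lost[OF that] by (auto simp: mem_D)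
    ultimately show ?thesis using adj by auto
  qed
  have "card (N W z - X) = 2"
    using dg X finite_N[OF g] by (simp add: card_Diff_subset finite_subset)
  then have "{p, q} = N W z - X"
    using sub adj finite_N[OF g, of z] by (intro card_subset_eq) auto
  then have N: "N W z = X \<union> {p, q}" using X by auto
  show ?thesis
  proof (rule that[OF N adj(1-3)])
    have "N W t \<subseteq> N ?D t \<union> insert w S \<union> N W w" for t by (auto simp: N_def D_def)
    from this[of p] this[of q] show "N W p \<subseteq> {z, q, w} \<union> S \<union> N W w"
      "N W q \<subseteq> {z, p, w} \<union> S \<union> N W w" unfolding pq by auto
  qed
qed

text \<open>A vertex is paired with exponents \<open>es\<close>; the branch at that vertex is bounded with the extra
  factor \<open>\<Sum>e\<leftarrow>es. icbrt2 ^ e\<close>.\<close>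
fun admissible :: "'a set \<Rightarrow> ('a \<times> nat list) list \<Rightarrow> bool" where
  "admissible W [] = True"
| "admissible W ((x, es) # ps) \<longleftrightarrow>
    bd (\<Sum>e\<leftarrow>es. icbrt2 ^ e) (D (W - set (map fst ps)) x) \<and> admissible W ps"

text \<open>\<open>[0]\<close> marks a plain branch; \<open>[2]\<close>, \<open>[3, 4]\<close> and
  \<open>[4, 5, 6]\<close> carry the factors of \<open>deg_le_1\<close>, \<open>deg_le_2\<close> and
  \<open>deg_le_3\<close>. Adding exponents leaves only powers of \<open>icbrt2\<close> to
  evaluate.\<close>

fun cost :: "'a set \<Rightarrow> ('a \<times> nat list) list \<Rightarrow> real" where
  "cost W [] = 0"
| "cost W ((x, es) # ps) =
    (\<Sum>e\<leftarrow>es. icbrt2 ^ (e + Suc (dg W x + length (filter (\<lambda>y. \<not> x \<sim> y) (map fst ps))))) + cost W ps"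

lemma branches_le_cost:
  assumes "hereditary W" "distinct (map fst ps)" "fst ` set ps \<subseteq> W" "admissible W ps"
  shows "branches W (map fst ps) \<le> cost W ps"
  using assms(2-4)
proof (induction ps)
  case (Cons p ps)
  obtain x es where p: "p = (x, es)" by fastforce
  have "0 \<le> (\<Sum>e\<leftarrow>es. icbrt2 ^ e)"
    using icbrt2_pos by (intro sum_list_nonneg) auto
  then have "nb W (D (W - set (map fst ps)) x) \<le>
      (\<Sum>e\<leftarrow>es. icbrt2 ^ e) * icbrt2 ^ Suc (dg W x + length (filter (\<lambda>y. \<not> x \<sim> y) (map fst ps)))"
    using Cons.prems assms(1) unfolding p by (intro term_le) auto
  also have "\<dots> = (\<Sum>e\<leftarrow>es. icbrt2 ^ (e + Suc (dg W x + length (filter (\<lambda>y. \<not> x \<sim> y) (map fst ps)))))"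
    unfolding power_add sum_list_mult_const ..
  finally show ?case using Cons unfolding p by simp
qed simp

section \<open>Minimal counterexamples to the first bound\<close>

definition counterex :: "'a set \<Rightarrow> bool" where "counterex W \<longleftrightarrow> hereditary W \<and> \<not> bd 1 W"

lemma counterex_hereditary: "counterex W \<Longrightarrow> hereditary W" by (simp add: counterex_def)

lemma counterex_cost:
  assumes "counterex W" "v \<in> W" "N W v = set (map fst ps)" "distinct (map fst ps)" "admissible W ps"
  shows "1 < cost W ps"
proof -
  have "fst ` set ps \<subseteq> W" using assms(3) by (auto simp: N_def)
  then have "branches W (map fst ps) \<le> cost W ps"
    using assms by (intro branches_le_cost) (auto simp: counterex_def)
  moreover have "nb W W \<le> branches W (map fst ps)"
    using assms by (intro expand[of W v]) (auto simp: counterex_def)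
  ultimately show ?thesis using assms(1) by (auto simp: counterex_def bd_iff_nb)
qed

text \<open>Both branches lose the whole triangle and weigh 1/2 each, so there is no slack
  here.\<close>

lemma tri_bd_1:
  assumes W: "hereditary W" "z \<in> W" "tri W z"
  shows "bd 1 W"
proof -
  obtain x y where xy: "N W z = {x, y}" "N W x = {z, y}" "N W y = {z, x}"
    using W(3) unfolding tri_def by blast
  note nx = nbr[OF xy(1), of x, simplified] and ny = nbr[OF xy(1), of y, simplified]
  have a: "x \<sim> y" "x \<noteq> y" "y \<sim> x" using nbr[OF xy(2), of y] by auto
  have d: "dg W x = 2" "dg W y = 2" using nx ny xy by auto
  have "nb W (D W x) \<le> icbrt2 ^ 3" using term_1[of W x "[]" 3] W nx d by simp
  moreover have "nb W (D (W - {x}) y) \<le> icbrt2 ^ 3" using term_1[of W y "[x]" 3] W nx ny d a by simp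
  moreover have "nb W W \<le> branches W [y, x]" using expand[OF W(1,2), of "[y, x]"] xy a by auto
  ultimately show ?thesis by (simp add: bd_iff_nb icbrt2_cube)
qed

text \<open>Deleting this one vertex is enough, since
  \<open>icbrt2 + icbrt2 ^ 7 \<le> 1\<close>.\<close>

lemma deg_ge_6:
  assumes W: "hereditary W" "x \<in> W" "6 \<le> dg W x"
  shows "bd 1 W"
proof -
  have "nb W W \<le> nb W (W - {x}) + branches W [x]"
    using branching[of W "[x]"] W hereditary_finite by simp
  moreover have "nb W (W - {x}) \<le> 1 * icbrt2 ^ 1"
  proof (rule nb_le[OF hereditary_finite[OF W(1)]])
    show "bd 1 (W - {x})" using W by (auto simp: hereditary_def)
    show "card (W - {x}) + 1 \<le> card W"
      using W card_gt_0_iff[of W] hereditary_finite[OF W(1)] by (auto simp: Suc_leI)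
  qed simp
  moreover have "nb W (D W x) \<le> icbrt2 ^ 7" using term_1[of W x "[]" 7] W by simp
  ultimately have "nb W W \<le> icbrt2 + icbrt2 ^ 7" by simp
  then show ?thesis unfolding bd_iff_nb using icbrt2_arith by linarith
qed

lemma counterex_deg:
  assumes "counterex W" "x \<in> W"
  shows "dg W x = 4 \<or> dg W x = 5"
proof -
  have g: "hereditary W" "\<not> bd 1 W" using assms(1) by (auto simp: counterex_def)
  have "\<alpha> \<le> 1" unfolding \<alpha>_def using icbrt2_arith by linarith
  then have "\<not> dg W x \<le> 3"
    using deg_le_3[OF g(1) assms(2)] tri_bd_1[OF g(1) assms(2)] g(2) bd_mono by blast
  moreover have "\<not> 6 \<le> dg W x" using deg_ge_6[OF g(1) assms(2)] g(2) by blast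
  ultimately show ?thesis by auto
qed

lemma counterex_deg_ge: "counterex W \<Longrightarrow> x \<in> W \<Longrightarrow> 4 \<le> dg W x"
  using counterex_deg[of W x] by auto

lemma N_eqI_4:
  assumes "4 \<le> dg W x" "N W x \<subseteq> {p, q, r, s}"
  shows "N W x = {p, q, r, s}"
proof (rule card_seteq)
  have "card {p, q, r, s} \<le> 4" by (simp add: card_insert_if)
  then show "card {p, q, r, s} \<le> card (N W x)" using assms(1) by simp
qed (use assms(2) in simp_all)

lemma N_eqI_5:
  assumes "5 \<le> dg W x" "N W x \<subseteq> {p, q, r, s, t}"
  shows "N W x = {p, q, r, s, t}"
proof (rule card_seteq)
  have "card {p, q, r, s, t} \<le> 5" by (simp add: card_insert_if)
  then show "card {p, q, r, s, t} \<le> card (N W x)" using assms(1) by simp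
qed (use assms(2) in simp_all)

lemma N_drop: "N W x \<subseteq> insert y A \<Longrightarrow> \<not> x \<sim> y \<Longrightarrow> N W x \<subseteq> A"
  using mem_N by blast

subsection \<open>Vertices of degree 4\<close>

lemma nbr4:
  assumes "N W v = {p, q, r, s}"
  shows "p \<in> W" "q \<in> W" "r \<in> W" "s \<in> W" "v \<sim> p" "v \<sim> q" "v \<sim> r" "v \<sim> s"
    "p \<sim> v" "q \<sim> v" "r \<sim> v" "s \<sim> v" "p \<noteq> v" "q \<noteq> v" "r \<noteq> v" "s \<noteq> v"
  using nbr[OF assms] by auto

lemma cost_4:
  assumes "counterex W" "v \<in> W" "N W v = {p, q, r, s}" "distinct [p, q, r, s]"
  shows "1 < cost W [(s, [0]), (r, [0]), (q, [0]), (p, [0])]"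
  using assms counterex_hereditary[OF assms(1)] nbr4[OF assms(3)]
  by (intro counterex_cost[of W v]) (auto simp: bd_1_D bd_1_D_empty)

text \<open>\<open>H = C\<^sub>4\<close>: after the deletion of \<open>N[p]\<close> the vertex \<open>r\<close> opposite to \<open>p\<close> keeps at most one neighbour,
  unless its degree is 5; likewise for the other diagonal.\<close>
lemma counterex_no_C4_aux:
  assumes B: "counterex W" "v \<in> W" "N W v = {p, q, r, s}" "distinct [p, q, r, s]"
    and e: "p \<sim> q" "q \<sim> r" "r \<sim> s" "s \<sim> p"
    and d: "dg W r = 4 \<or> dg W p = 5" "dg W s = 4 \<or> dg W q = 5"
  shows False
proof -
  note g = counterex_hereditary[OF B(1)] and nb = nbr4[OF B(3)]
  have n: "\<not> p \<sim> r" "\<not> q \<sim> s" "\<not> r \<sim> p" "\<not> s \<sim> q"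
    using K4[of v p q r] K4[of v q r s] nb e sym by blast+
  note e' = e sym[OF e(1)] sym[OF e(2)] sym[OF e(3)] sym[OF e(4)] n
  have dv: "dg W p = 4 \<or> dg W p = 5" "dg W q = 4 \<or> dg W q = 5" "dg W r = 4 \<or> dg W r = 5" "dg W s = 4 \<or> dg W s = 5"
    using counterex_deg[OF B(1)] nb by blast+
  have 1: "bd (icbrt2 ^ 2) (D (W - {}) p)" if "dg W r = 4"
    by (rule lost_1[OF g, of r _ _ "{v, q, s}"])
      (use that nb e' B(2,4) in \<open>auto simp: mem_D mem_N card_insert_if\<close>)
  have 2: "bd (icbrt2 ^ 2) (D (W - {r, p}) q)" if "dg W s = 4"
    by (rule lost_1[OF g, of s _ _ "{v, r, p}"])
      (use that nb e' B(2,4) in \<open>auto simp: mem_D mem_N card_insert_if\<close>)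
  define x where "x = (if dg W r = 4 then [2::nat] else [0])"
  define y where "y = (if dg W s = 4 then [2::nat] else [0])"
  have "1 < cost W [(s, [0]), (q, y), (r, [0]), (p, x)]"
    using B g nb 1 2 by (intro counterex_cost[of W v]) (auto simp: bd_1_D bd_1_D_empty x_def y_def insert_commute)
  then show False
    using d dv e' icbrt2_bounds by (auto simp: x_def y_def icbrt2_powers simp del: power_Suc)
qed

text \<open>If the degree condition of the auxiliary lemma fails on a diagonal, swapping the two
  ends of that diagonal restores it.\<close>

lemma counterex_no_C4:
  assumes B: "counterex W" "v \<in> W" "N W v = {p, q, r, s}" "distinct [p, q, r, s]"
    and e: "p \<sim> q" "q \<sim> r" "r \<sim> s" "s \<sim> p"
  shows False
proof -
  have e': "q \<sim> p" "r \<sim> q" "s \<sim> r" "p \<sim> s" using e sym by blast+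
  have dv: "dg W r = 4 \<or> dg W r = 5" "dg W s = 4 \<or> dg W s = 5"
    using counterex_deg[OF B(1)] nbr4[OF B(3)] by blast+
  have "N W v = {r, q, p, s}" "N W v = {p, s, r, q}" "N W v = {r, s, p, q}" using B(3) by auto
  then show False
    using counterex_no_C4_aux[OF B e] counterex_no_C4_aux[OF B(1,2), of r q p s] counterex_no_C4_aux[OF B(1,2), of p s r q]
      counterex_no_C4_aux[OF B(1,2), of r s p q] B(4) e e' dv by (cases "dg W r = 4"; cases "dg W s = 4") auto
qed

text \<open>The ends are deleted first: without \<open>p\<close> and N[s], the inner vertex
  \<open>q\<close> has lost \<open>v\<close>, \<open>p\<close> and \<open>r\<close> and keeps degree
  at most 1.\<close>

lemma counterex_no_P4_aux:
  assumes B: "counterex W" "v \<in> W" "N W v = {p, q, r, s}" "distinct [p, q, r, s]"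
    and e: "p \<sim> q" "q \<sim> r" "r \<sim> s" "\<not> p \<sim> s" and d: "dg W q = 4"
  shows False
proof -
  note g = counterex_hereditary[OF B(1)] and nb = nbr4[OF B(3)]
  have n: "\<not> p \<sim> r" "\<not> q \<sim> s" "\<not> r \<sim> p" "\<not> s \<sim> q" "\<not> s \<sim> p"
    using K4[of v p q r] K4[of v q r s] nb e sym by blast+
  note e' = e sym[OF e(1)] sym[OF e(2)] sym[OF e(3)] n
  have dv: "dg W p = 4 \<or> dg W p = 5" "dg W r = 4 \<or> dg W r = 5" "dg W s = 4 \<or> dg W s = 5"
    using counterex_deg[OF B(1)] nb by blast+
  have "bd (icbrt2 ^ 2) (D (W - {p}) s)"
    by (rule lost_1[OF g, of q _ _ "{v, p, r}"])
      (use d nb e' B(2,4) in \<open>auto simp: mem_D mem_N card_insert_if\<close>)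
  then have "1 < cost W [(r, [0]), (q, [0]), (s, [2]), (p, [0])]"
    using B g nb by (intro counterex_cost[of W v]) (auto simp: bd_1_D bd_1_D_empty)
  then show False
    using d dv e' icbrt2_bounds by (auto simp: icbrt2_powers simp del: power_Suc)
qed

text \<open>If both inner vertices have degree 5, the plain branches already weigh less than
  1.\<close>

lemma counterex_no_P4:
  assumes B: "counterex W" "v \<in> W" "N W v = {p, q, r, s}" "distinct [p, q, r, s]"
    and e: "p \<sim> q" "q \<sim> r" "r \<sim> s" "\<not> p \<sim> s"
  shows False
proof -
  note g = counterex_hereditary[OF B(1)] and nb = nbr4[OF B(3)]
  have n: "\<not> p \<sim> r" "\<not> q \<sim> s" "\<not> r \<sim> p" "\<not> s \<sim> q" "\<not> s \<sim> p"
    using K4[of v p q r] K4[of v q r s] nb e sym by blast+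
  note e' = e sym[OF e(1)] sym[OF e(2)] sym[OF e(3)] n
  have dv: "dg W p = 4 \<or> dg W p = 5" "dg W q = 4 \<or> dg W q = 5" "dg W r = 4 \<or> dg W r = 5" "dg W s = 4 \<or> dg W s = 5"
    using counterex_deg[OF B(1)] nb by blast+
  have "N W v = {s, r, q, p}" using B(3) by auto
  then have "dg W q = 5" "dg W r = 5"
    using counterex_no_P4_aux[OF B e] counterex_no_P4_aux[OF B(1,2), of s r q p] B(4) e' dv by auto
  moreover have "1 < cost W [(r, [0]), (q, [0]), (s, [0]), (p, [0])]"
    by (rule cost_4[OF B(1,2)]) (use B in auto)
  ultimately show False
    using dv e' icbrt2_bounds by (auto simp: icbrt2_powers simp del: power_Suc)
qed

text \<open>H has at most the edge between \<open>r\<close> and \<open>s\<close>; deleting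
  \<open>r\<close>, \<open>q\<close>, \<open>s\<close>, \<open>p\<close> loses at least 5, 6, 6 and
  8 vertices.\<close>

lemma counterex_no_isolated_2:
  assumes B: "counterex W" "v \<in> W" "N W v = {p, q, r, s}" "distinct [p, q, r, s]"
    and e: "\<not> p \<sim> q" "\<not> p \<sim> r" "\<not> p \<sim> s" "\<not> q \<sim> r" "\<not> q \<sim> s"
  shows False
proof -
  note nb = nbr4[OF B(3)]
  have e': "\<not> s \<sim> q" using e sym by blast
  have dv: "dg W p = 4 \<or> dg W p = 5" "dg W q = 4 \<or> dg W q = 5" "dg W r = 4 \<or> dg W r = 5" "dg W s = 4 \<or> dg W s = 5"
    using counterex_deg[OF B(1)] nb by blast+
  have "1 < cost W [(p, [0]), (s, [0]), (q, [0]), (r, [0])]"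
    by (rule cost_4[OF B(1,2)]) (use B in auto)
  then show False
    using dv e e' icbrt2_bounds by (auto simp: icbrt2_powers simp del: power_Suc split: if_splits)
qed

section \<open>H is a path on three vertices plus an isolated vertex\<close>

lemma counterex_P3_K1_deg:
  assumes B: "counterex W" "v \<in> W" "N W v = {p, q, r, s}" "distinct [p, q, r, s]"
    and e: "q \<sim> r" "r \<sim> s" "\<not> p \<sim> q" "\<not> p \<sim> r" "\<not> p \<sim> s"
  shows "dg W p = 4 \<and> dg W q = 4 \<and> dg W r = 4 \<and> dg W s = 4"
proof (rule ccontr)
  assume neg: "\<not> ?thesis"
  note nb = nbr4[OF B(3)]
  have e': "\<not> q \<sim> s" "\<not> s \<sim> q" "\<not> q \<sim> p" "\<not> r \<sim> p" "\<not> s \<sim> p" "r \<sim> q" "s \<sim> r"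
    using K4[of v q r s] nb e sym by blast+
  have dv: "dg W p = 4 \<or> dg W p = 5" "dg W q = 4 \<or> dg W q = 5" "dg W r = 4 \<or> dg W r = 5" "dg W s = 4 \<or> dg W s = 5"
    using counterex_deg[OF B(1)] nb by blast+
  \<comment> \<open>Losses 5, 6, 6, 7 weigh about 1.01; a single degree 5 brings the sum below
    1.\<close>
  have "1 < cost W [(s, [0]), (r, [0]), (q, [0]), (p, [0])]"
    by (rule cost_4[OF B])
  then show False
    using dv neg e e' icbrt2_bounds by (auto simp: icbrt2_powers simp del: power_Suc)
qed

text \<open>Losing N[q] takes \<open>v\<close> and \<open>r\<close> from \<open>s\<close>, which
  keeps degree at most 2. Outside a triangle component the factor of \<open>deg_le_2\<close> would
  push the sum below 1.\<close>

lemma counterex_P3_K1_tri: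
  assumes B: "counterex W" "v \<in> W" "N W v = {p, q, r, s}" "distinct [p, q, r, s]"
    and e: "q \<sim> r" "r \<sim> s" "\<not> p \<sim> q" "\<not> p \<sim> r" "\<not> p \<sim> s"
  shows "tri (D (W - {}) q) s"
proof (rule ccontr)
  assume neg: "\<not> ?thesis"
  note g = counterex_hereditary[OF B(1)] and nb = nbr4[OF B(3)] and d = counterex_P3_K1_deg[OF B e]
  have e': "\<not> q \<sim> s" "\<not> s \<sim> q" "\<not> q \<sim> p" "\<not> r \<sim> p" "\<not> s \<sim> p" "r \<sim> q" "s \<sim> r"
    using K4[of v q r s] nb e sym by blast+
  have "bd (icbrt2 ^ 3 + icbrt2 ^ 4) (D (W - {}) q)"
    by (rule lost_2[OF g _ _ _ _ neg, of "{v, r}"])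
      (use d nb e e' B(2,4) in \<open>auto simp: mem_D mem_N card_insert_if\<close>)
  then have "1 < cost W [(r, [0]), (p, [0]), (s, [0]), (q, [3, 4])]"
    using B g nb by (intro counterex_cost[of W v]) (auto simp: bd_1_D bd_1_D_empty)
  then show False
    using d e e' icbrt2_bounds by (auto simp: icbrt2_powers simp del: power_Suc)
qed

text \<open>\<open>x\<close> and \<open>x'\<close> need degree 4 and have at most five possible
  neighbours; missing each other, both must use \<open>r\<close>, which then has five
  neighbours.\<close>

lemma P3_K1_core:
  assumes B: "counterex W" and W: "{v, q, r, s, x, y, x', y'} \<subseteq> W" "distinct [v, q, s, x, x']"
    and r: "dg W r = 4" "r \<sim> v" "r \<sim> q" "r \<sim> s"
    and x: "N W x \<subseteq> {s, y, r, x', y'}" and x': "N W x' \<subseteq> {q, y', r, x, y}"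
    and n: "\<not> x \<sim> x'"
  shows False
proof -
  have "N W x \<subseteq> {s, y, r, y'}" by (rule N_drop[OF _ n]) (use x in auto)
  then have "N W x = {s, y, r, y'}" by (rule N_eqI_4[rotated]) (use counterex_deg_ge[OF B] W in auto)
  then have 1: "x \<sim> r" by (rule nbr(2)) simp
  have "N W x' \<subseteq> {q, y', r, y}" by (rule N_drop[OF _ n[unfolded sym_iff[of x]]]) (use x' in auto)
  then have "N W x' = {q, y', r, y}" by (rule N_eqI_4[rotated]) (use counterex_deg_ge[OF B] W in auto)
  then have 2: "x' \<sim> r" by (rule nbr(2)) simp
  have "{v, q, s, x, x'} \<subseteq> N W r" using W r(2-4) sym[OF 1] sym[OF 2] by (simp add: mem_N)
  then have "card {v, q, s, x, x'} \<le> dg W r" by (intro card_mono finite_N counterex_hereditary[OF B])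
  moreover have "card {v, q, s, x, x'} = 5" using W(2) distinct_card[of "[v, q, s, x, x']"] by simp
  ultimately show False using r(1) by simp
qed

text \<open>By symmetry there are two triangles, \<open>s\<close>, \<open>x\<close>,
  \<open>y\<close> and \<open>q\<close>, \<open>x'\<close>, \<open>y'\<close>. Edges leaving the
  first at \<open>x\<close> or \<open>y\<close>, or the second at \<open>x'\<close> or
  \<open>y'\<close>, go to \<open>r\<close> or to the other pair. Some edge between the two pairs is
  missing, and \<open>P3_K1_core\<close> applies to it.\<close>

lemma counterex_no_P3_K1:
  assumes B: "counterex W" "v \<in> W" "N W v = {p, q, r, s}" "distinct [p, q, r, s]"
    and e: "q \<sim> r" "r \<sim> s" "\<not> p \<sim> q" "\<not> p \<sim> r" "\<not> p \<sim> s"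
  shows False
proof -
  note g = counterex_hereditary[OF B(1)] and nb = nbr4[OF B(3)] and d = counterex_P3_K1_deg[OF B e]
  have e': "\<not> q \<sim> s" "\<not> s \<sim> q" "\<not> q \<sim> p" "\<not> r \<sim> p" "\<not> s \<sim> p" "r \<sim> q" "s \<sim> r"
    using K4[of v q r s] nb e sym by blast+
  have B': "N W v = {p, s, r, q}" "distinct [p, s, r, q]" using B(3,4) by auto
  have vr: "v \<noteq> r" using nb by blast
  have lost: "{v, r} \<subseteq> N W s" "{v, r} \<subseteq> N W q" "card {v, r} = 2"
    "\<And>x. x \<in> {v, r} \<Longrightarrow> x \<in> {} \<or> q \<sim> x" "\<And>x. x \<in> {v, r} \<Longrightarrow> x \<in> {} \<or> s \<sim> x"
    using nb e e' B(2) vr by (auto simp: mem_N)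
  obtain x y where s: "N W s = {v, r} \<union> {x, y}" "x \<sim> y" "x \<in> D (W - {}) q" "y \<in> D (W - {}) q"
    "N W x \<subseteq> {s, y, q} \<union> {} \<union> N W q" "N W y \<subseteq> {s, x, q} \<union> {} \<union> N W q"
    by (rule triE[OF g counterex_P3_K1_tri[OF B e] lost(1,4)]) (use d lost(3) in auto)
  obtain x' y' where q: "N W q = {v, r} \<union> {x', y'}" "x' \<sim> y'" "x' \<in> D (W - {}) s" "y' \<in> D (W - {}) s"
    "N W x' \<subseteq> {q, y', s} \<union> {} \<union> N W s" "N W y' \<subseteq> {q, x', s} \<union> {} \<union> N W s"
    by (rule triE[OF g counterex_P3_K1_tri[OF B(1,2) B' e'(7,6) e(5,4,3)] lost(2,5)]) (use d lost(3) in auto)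
  have xW: "x \<in> W" "y \<in> W" "x' \<in> W" "y' \<in> W" using s(3,4) q(3,4) by (simp_all add: mem_D)
  have nadj: "\<not> q \<sim> x" "\<not> q \<sim> y" "\<not> s \<sim> x'" "\<not> s \<sim> y'"
    using s(3,4) q(3,4) by (simp_all add: mem_D)
  have adj: "s \<sim> x" "s \<sim> y" "q \<sim> x'" "q \<sim> y'"
    using nbr(2)[OF s(1)] nbr(2)[OF q(1)] by simp_all
  have out: "\<not> w \<sim> v \<and> w \<notin> {v, q, s}" if "w \<in> {x, y, x', y'}" for w
  proof -
    have "w \<in> W" using that xW by blast
    have "w \<noteq> p" "w \<noteq> q" "w \<noteq> r" "w \<noteq> s" "w \<noteq> v"
      using that adj nadj e e' irrefl nb by blast+
    then have "w \<notin> N W v" using B(3) by simp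
    then have "\<not> w \<sim> v" using \<open>w \<in> W\<close> sym[of w v] mem_N by blast
    then show ?thesis using \<open>w \<noteq> v\<close> \<open>w \<noteq> q\<close> \<open>w \<noteq> s\<close> by simp
  qed
  have "\<not> x \<sim> v" "\<not> y \<sim> v" "\<not> x' \<sim> v" "\<not> y' \<sim> v" using out by simp_all
  note nv = this and nadj' = nadj[unfolded sym_iff[of q] sym_iff[of s]]
  have X: "N W x \<subseteq> {s, y, r, x', y'}"
    by (rule N_drop[OF N_drop[OF _ nv(1)] nadj'(1)]) (use s(5) q(1) in auto)
  have Y: "N W y \<subseteq> {s, x, r, x', y'}"
    by (rule N_drop[OF N_drop[OF _ nv(2)] nadj'(2)]) (use s(6) q(1) in auto)
  have X': "N W x' \<subseteq> {q, y', r, x, y}"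
    by (rule N_drop[OF N_drop[OF _ nv(3)] nadj'(3)]) (use q(5) s(1) in auto)
  have Y': "N W y' \<subseteq> {q, x', r, x, y}"
    by (rule N_drop[OF N_drop[OF _ nv(4)] nadj'(4)]) (use q(6) s(1) in auto)
  have ne: "distinct [v, q, s, w, w']" if "w \<in> {x, y}" "w' \<in> {x', y'}" for w w'
  proof -
    have "w \<noteq> w'" using that adj nadj by blast
    moreover have "w \<notin> {v, q, s}" "w' \<notin> {v, q, s}" using that out by blast+
    ultimately show ?thesis using nb B(4) by auto
  qed
  have sub: "{v, q, r, s, x, y, x', y'} \<subseteq> W" using xW nb B(2) by auto
  have rr: "dg W r = 4" "r \<sim> v" "r \<sim> q" "r \<sim> s" using d nb e e' by auto
  \<comment> \<open>Missing \<open>r\<close> makes \<open>z\<close> adjacent to both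
    \<open>x'\<close> and \<open>y'\<close>; if \<open>w\<close> were too, these four vertices would
    form a complete graph.\<close>
  have k1: "\<not> (w \<sim> x' \<and> w \<sim> y')" if "\<not> z \<sim> r" "w \<sim> z" "z \<in> W" "N W z \<subseteq> {s, w, r, x', y'}" for w z
  proof -
    have "N W z \<subseteq> {s, w, x', y'}" by (rule N_drop[OF _ that(1)]) (use that(4) in auto)
    then have N: "N W z = {s, w, x', y'}" by (rule N_eqI_4[rotated]) (rule counterex_deg_ge[OF B(1) that(3)])
    have "z \<sim> x'" "z \<sim> y'" using nbr(2)[OF N] by simp_all
    then show ?thesis using K4[of w z x' y'] that(2) q(2) by blast
  qed
  have "\<not> (x \<sim> r \<and> y \<sim> r)"
    using K4[of r s x y] e(2) adj s(2) sym by blast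
  then consider "\<not> x \<sim> x'" | "\<not> x \<sim> y'" | "\<not> y \<sim> x'" | "\<not> y \<sim> y'"
    using k1[of y x, OF _ s(2) xW(2) Y] k1[of x y, OF _ sym[OF s(2)] xW(1) X] by blast
  then show False
  proof cases
    case 1
    show False by (rule P3_K1_core[OF B(1) sub ne rr X X' 1]) simp_all
  next
    case 2
    show False
      by (rule P3_K1_core[OF B(1) _ ne[of x y'] rr _ _ 2, of y x']) (use sub X Y' in auto)
  next
    case 3
    show False
      by (rule P3_K1_core[OF B(1) _ ne[of y x'] rr _ _ 3, of x y']) (use sub Y X' in auto)
  next
    case 4
    show False
      by (rule P3_K1_core[OF B(1) _ ne[of y y'] rr _ _ 4, of x x']) (use sub Y Y' in auto)
  qed
qed

section \<open>H consists of two disjoint edges\<close>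

lemma counterex_2K2_deg:
  assumes B: "counterex W" "v \<in> W" "N W v = {p, q, r, s}" "distinct [p, q, r, s]"
    and e: "p \<sim> q" "r \<sim> s" "\<not> p \<sim> r" "\<not> p \<sim> s" "\<not> q \<sim> r" "\<not> q \<sim> s"
  shows "dg W p = 4 \<and> dg W q = 4 \<and> dg W r = 4 \<and> dg W s = 4"
proof (rule ccontr)
  assume neg: "\<not> ?thesis"
  note nb = nbr4[OF B(3)]
  have e': "q \<sim> p" "s \<sim> r" "\<not> r \<sim> p" "\<not> s \<sim> p" "\<not> r \<sim> q" "\<not> s \<sim> q"
    using e sym by blast+
  have dv: "dg W p = 4 \<or> dg W p = 5" "dg W q = 4 \<or> dg W q = 5" "dg W r = 4 \<or> dg W r = 5" "dg W s = 4 \<or> dg W s = 5"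
    using counterex_deg[OF B(1)] nb by blast+
  have "1 < cost W [(s, [0]), (q, [0]), (r, [0]), (p, [0])]"
    by (rule cost_4[OF B(1,2)]) (use B in auto)
  then show False
    using dv neg e e' icbrt2_bounds by (auto simp: icbrt2_powers simp del: power_Suc)
qed

text \<open>Without \<open>p\<close> and N[r], the vertex \<open>q\<close> has lost \<open>v\<close>
  and \<open>p\<close> and keeps degree at most 2; only a triangle component avoids the factor of
  \<open>deg_le_2\<close>.\<close>

lemma counterex_2K2_tri:
  assumes B: "counterex W" "v \<in> W" "N W v = {p, q, r, s}" "distinct [p, q, r, s]"
    and e: "p \<sim> q" "r \<sim> s" "\<not> p \<sim> r" "\<not> p \<sim> s" "\<not> q \<sim> r" "\<not> q \<sim> s"
  shows "tri (D (W - {p}) r) q"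
proof (rule ccontr)
  assume neg: "\<not> ?thesis"
  note g = counterex_hereditary[OF B(1)] and nb = nbr4[OF B(3)] and d = counterex_2K2_deg[OF B e]
  have e': "q \<sim> p" "s \<sim> r" "\<not> r \<sim> p" "\<not> s \<sim> p" "\<not> r \<sim> q" "\<not> s \<sim> q"
    using e sym by blast+
  have "bd (icbrt2 ^ 3 + icbrt2 ^ 4) (D (W - {p}) r)"
    by (rule lost_2[OF g _ _ _ _ neg, of "{v, p}"])
      (use d nb e e' B(2,4) in \<open>auto simp: mem_D mem_N card_insert_if\<close>)
  then have "1 < cost W [(s, [0]), (q, [0]), (r, [3, 4]), (p, [0])]"
    using B g nb by (intro counterex_cost[of W v]) (auto simp: bd_1_D bd_1_D_empty)
  then show False
    using d e e' icbrt2_bounds by (auto simp: icbrt2_powers simp del: power_Suc)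
qed

section \<open>Adjacent twins of degree 4\<close>

lemma twins_core:
  assumes B: "counterex W" and W: "{p, r, s, t, s', t', x, y} \<subseteq> W"
    and r: "dg W r = 4" "{v, m} \<subseteq> N W r" "v \<noteq> m"
    and out: "{s, t, s', t'} \<inter> {v, m, p, q} = {}"
    and N: "N W x = {q, y, s', t'}" "N W y = {q, x, s, t}" "s \<sim> t" "s' \<sim> t'"
    and s: "N W s \<subseteq> {y, t, x, p, r}" and t: "N W t \<subseteq> {y, s, x, p, r}"
    and s': "N W s' \<subseteq> {x, t', y, p, r}" and t': "N W t' \<subseteq> {x, s', y, p, r}"
    and n: "\<not> s \<sim> x" "\<not> s' \<sim> y" and ne: "s' \<noteq> y"
  shows False
proof -
  note ge = counterex_deg_ge[OF B]
  have adj: "x \<sim> s'" "x \<sim> t'" "y \<sim> s" "y \<sim> t"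
    using nbr(2)[OF N(1)] nbr(2)[OF N(2)] by simp_all
  have "N W s \<subseteq> {y, t, p, r}" by (rule N_drop[OF _ n(1)]) (use s in auto)
  then have Ns: "N W s = {y, t, p, r}" by (rule N_eqI_4[rotated]) (use ge W in auto)
  have "N W s' \<subseteq> {x, t', p, r}" by (rule N_drop[OF _ n(2)]) (use s' in auto)
  then have Ns': "N W s' = {x, t', p, r}" by (rule N_eqI_4[rotated]) (use ge W in auto)
  have "s \<noteq> s'" using adj(3) n(2) sym by blast
  have "s \<in> N W r" "s' \<in> N W r"
    using nbr(3)[OF Ns, of r] nbr(3)[OF Ns', of r] W by (auto simp: mem_N)
  then have "{v, m, s, s'} \<subseteq> N W r" using r(2) by simp
  moreover have "card {v, m, s, s'} = 4" using r(3) \<open>s \<noteq> s'\<close> out by auto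
  \<comment> \<open>These four vertices exhaust the degree of \<open>r\<close>, so \<open>t\<close>
    and \<open>t'\<close> must find their four neighbours without it.\<close>
  ultimately have Nr: "N W r = {v, m, s, s'}"
    using r(1) finite_N[OF counterex_hereditary[OF B], of r] card_subset_eq by metis
  have "t \<noteq> s'" "t' \<noteq> s" using adj n sym by blast+
  moreover have "t \<noteq> s" "t' \<noteq> s'" using N(3,4) irrefl by auto
  ultimately have "t \<notin> N W r" "t' \<notin> N W r" using Nr out by auto
  then have nr: "\<not> t \<sim> r" "\<not> t' \<sim> r" using W sym by (auto simp: mem_N)
  have "N W t \<subseteq> {y, s, x, p}" by (rule N_drop[OF _ nr(1)]) (use t in auto)
  then have Nt: "N W t = {y, s, x, p}" by (rule N_eqI_4[rotated]) (use ge W in auto)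
  have "N W t' \<subseteq> {x, s', y, p}" by (rule N_drop[OF _ nr(2)]) (use t' in auto)
  then have Nt': "N W t' = {x, s', y, p}" by (rule N_eqI_4[rotated]) (use ge W in auto)
  have "t \<in> N W x" using nbr(3)[OF Nt, of x] W by (auto simp: mem_N)
  moreover have "t \<noteq> y" using adj(4) irrefl by blast
  ultimately have "t = t'" using N(1) \<open>t \<noteq> s'\<close> out by auto
  \<comment> \<open>With \<open>t = t'\<close> the two descriptions of its neighbourhood must agree,
    but \<open>s'\<close> occurs in only one of them.\<close>
  then have "s' \<in> {y, s, x, p}" using Nt Nt' by blast
  moreover have "s' \<noteq> x" using adj(1) irrefl by blast
  ultimately show False using \<open>s \<noteq> s'\<close> out ne by auto
qed

text \<open>The neighbourhood of \<open>q\<close> consists of two disjoint edges,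
  \<open>v\<close>-\<open>m\<close> and \<open>x\<close>-\<open>y\<close>. By
  \<open>counterex_2K2_tri\<close> at \<open>q\<close>, \<open>y\<close> lies in a triangle
  component after the loss of \<open>x\<close> and N[v], and \<open>x\<close> in one after the loss
  of \<open>y\<close> and N[v].\<close>

lemma counterex_no_twins_aux:
  assumes B: "counterex W" "v \<in> W" "N W v = {m, p, q, r}" "N W m = {v, p, q, r}" "distinct [m, p, q, r]"
    and d: "dg W q = 4" "dg W r = 4"
  shows False
proof -
  note g = counterex_hereditary[OF B(1)] and nb = nbr4[OF B(3)] and nm = nbr4[OF B(4)]
  have n: "\<not> p \<sim> q" "\<not> p \<sim> r" "\<not> q \<sim> r"
    using K4[of v m p q] K4[of v m p r] K4[of v m q r] nb nm by blast+
  have vm: "{v, m} \<subseteq> N W q" "{v, m} \<subseteq> N W r" "v \<noteq> m"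
    using nb nm B(2) by (auto simp: mem_N)
  then obtain x y where xy: "N W q = {v, m} \<union> {x, y}" "x \<noteq> y" "x \<notin> {v, m}" "y \<notin> {v, m}"
    using two_more[of "N W q" "{v, m}"] d(1) finite_N[OF g, of q] by auto
  have Nq: "N W q = {x, y, v, m}" "N W q = {y, x, v, m}" "distinct [x, y, v, m]" "distinct [y, x, v, m]"
    using xy vm(3) by auto
  note nq = nbr4[OF Nq(1)]
  have qW: "q \<in> W" by (rule nb)
  have "x \<noteq> p" "x \<noteq> q" "x \<noteq> r" "y \<noteq> p" "y \<noteq> q" "y \<noteq> r"
    using nq n sym irrefl by blast+
  then have "x \<notin> N W v" "x \<notin> N W m" "y \<notin> N W v" "y \<notin> N W m" using B(3,4) xy by auto
  then have nx: "\<not> x \<sim> v" "\<not> x \<sim> m" "\<not> y \<sim> v" "\<not> y \<sim> m"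
    using nq(1,2) sym by (auto simp: mem_N)
  have exy: "x \<sim> y"
    using counterex_no_isolated_2[OF B(1) qW Nq(1,3)] nx by blast
  have evm: "v \<sim> m" by (rule nb)
  note t1 = counterex_2K2_tri[OF B(1) qW Nq(1,3) exy evm nx(1,2,3,4)]
    and t2 = counterex_2K2_tri[OF B(1) qW Nq(2,4) sym[OF exy] evm nx(3,4,1,2)]
    and dg = counterex_2K2_deg[OF B(1) qW Nq(1,3) exy evm nx(1,2,3,4)]
  have lost: "{q, x} \<subseteq> N W y" "{q, y} \<subseteq> N W x" "card {q, x} = 2" "card {q, y} = 2"
    "\<And>z. z \<in> {q, x} \<Longrightarrow> z \<in> {x} \<or> v \<sim> z" "\<And>z. z \<in> {q, y} \<Longrightarrow> z \<in> {y} \<or> v \<sim> z"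
    using nq qW exy sym[OF exy] nb \<open>x \<noteq> q\<close> \<open>y \<noteq> q\<close> by (auto simp: mem_N)
  obtain s t where s: "N W y = {q, x} \<union> {s, t}" "s \<sim> t" "s \<in> D (W - {x}) v" "t \<in> D (W - {x}) v"
    "N W s \<subseteq> {y, t, v} \<union> {x} \<union> N W v" "N W t \<subseteq> {y, s, v} \<union> {x} \<union> N W v"
    by (rule triE[OF g t1 lost(1,5)]) (use dg lost(3) in auto)
  obtain s' t' where s': "N W x = {q, y} \<union> {s', t'}" "s' \<sim> t'" "s' \<in> D (W - {y}) v" "t' \<in> D (W - {y}) v"
    "N W s' \<subseteq> {x, t', v} \<union> {y} \<union> N W v" "N W t' \<subseteq> {x, s', v} \<union> {y} \<union> N W v"
    by (rule triE[OF g t2 lost(2,6)]) (use dg lost(4) in auto)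
  have W': "s \<in> W" "t \<in> W" "s' \<in> W" "t' \<in> W" using s(3,4) s'(3,4) by (simp_all add: mem_D)
  have nv: "\<not> v \<sim> s" "\<not> v \<sim> t" "\<not> v \<sim> s'" "\<not> v \<sim> t'" "s \<noteq> v" "t \<noteq> v" "s' \<noteq> v" "t' \<noteq> v"
    "s \<noteq> x" "t \<noteq> x" "s' \<noteq> y" "t' \<noteq> y"
    using s(3,4) s'(3,4) by (simp_all add: mem_D)
  have adj: "x \<sim> s'" "x \<sim> t'" "y \<sim> s" "y \<sim> t"
    using nbr(2)[OF s(1)] nbr(2)[OF s'(1)] by simp_all
  have out: "{s, t, s', t'} \<inter> {v, m, p, q, r} = {}" using nv nb by blast
  have "s \<noteq> y" "t \<noteq> y" "s' \<noteq> x" "t' \<noteq> x" using adj irrefl by blast+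
  then have "z \<notin> N W q \<and> z \<notin> N W m" if "z \<in> {s, t, s', t'}" for z
    using that out nv B(4) Nq(1) by auto
  then have nqm: "\<not> z \<sim> q" "\<not> z \<sim> m" "\<not> z \<sim> v" if "z \<in> {s, t, s', t'}" for z
    using that W' nv sym by (auto simp: mem_N)
  have S: "N W s \<subseteq> {y, t, x, p, r}"
    by (rule N_drop[OF N_drop[OF N_drop[OF _ nqm(1)] nqm(2)] nqm(3)]) (use s(5) B(3) in auto)
  have T: "N W t \<subseteq> {y, s, x, p, r}"
    by (rule N_drop[OF N_drop[OF N_drop[OF _ nqm(1)] nqm(2)] nqm(3)]) (use s(6) B(3) in auto)
  have S': "N W s' \<subseteq> {x, t', y, p, r}"
    by (rule N_drop[OF N_drop[OF N_drop[OF _ nqm(1)] nqm(2)] nqm(3)]) (use s'(5) B(3) in auto)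
  have T': "N W t' \<subseteq> {x, s', y, p, r}"
    by (rule N_drop[OF N_drop[OF N_drop[OF _ nqm(1)] nqm(2)] nqm(3)]) (use s'(6) B(3) in auto)
  have k1: "\<not> s \<sim> x \<or> \<not> t \<sim> x" using K4[of x y s t] exy adj s(2) sym by blast
  have k2: "\<not> s' \<sim> y \<or> \<not> t' \<sim> y" using K4[of y x s' t'] exy adj s'(2) sym by blast
  have Wp: "p \<in> W" "r \<in> W" "x \<in> W" "y \<in> W" by (rule nb nq)+
  note core = twins_core[OF B(1) _ d(2) vm(2,3), of p _ _ _ _ x y q]
  from k1 k2 consider "\<not> s \<sim> x" "\<not> s' \<sim> y" | "\<not> s \<sim> x" "\<not> t' \<sim> y" | "\<not> t \<sim> x" "\<not> s' \<sim> y" | "\<not> t \<sim> x" "\<not> t' \<sim> y"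
    by blast
  then show False
  proof cases
    case 1
    show False
      by (rule core[of s t s' t']) (use 1 Wp W' out s(1,2) s'(1,2) S T S' T' nv in auto)
  next
    case 2
    show False
      by (rule core[of s t t' s']) (use 2 Wp W' out s(1,2) s'(1,2) sym[OF s'(2)] S T S' T' nv in auto)
  next
    case 3
    show False
      by (rule core[of t s s' t']) (use 3 Wp W' out s(1,2) s'(1,2) sym[OF s(2)] S T S' T' nv in auto)
  next
    case 4
    show False
      by (rule core[of t s t' s']) (use 4 Wp W' out s(1,2) s'(1,2) sym[OF s(2)] sym[OF s'(2)] S T S' T' nv in auto)
  qed
qed

lemma counterex_no_twins:
  assumes B: "counterex W" "v \<in> W" "N W v = {m, p, q, r}" "N W m = {v, p, q, r}" "distinct [m, p, q, r]"
  shows False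
proof -
  note g = counterex_hereditary[OF B(1)] and nb = nbr4[OF B(3)] and nm = nbr4[OF B(4)]
  have n: "\<not> p \<sim> q" "\<not> p \<sim> r" "\<not> q \<sim> r" "\<not> q \<sim> p" "\<not> r \<sim> p" "\<not> r \<sim> q"
    using K4[of v m p q] K4[of v m p r] K4[of v m q r] nb nm sym by blast+
  have dm: "dg W m = 4" using B nb nm by auto
  have dv: "dg W p = 4 \<or> dg W p = 5" "dg W q = 4 \<or> dg W q = 5" "dg W r = 4 \<or> dg W r = 5"
    using counterex_deg[OF B(1)] nb by blast+
  \<comment> \<open>With two vertices of degree 5 among the three, the losses are at least 6, 7, 7
    and 5, of weight below 1. So two of them have degree 4 and the auxiliary lemma applies.\<close>
  have two5: False if "N W v = {m, p', q', r'}" "distinct [m, p', q', r']" "dg W p' = 5" "dg W q' = 5"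
    "\<not> p' \<sim> q'" "\<not> p' \<sim> r'" "\<not> q' \<sim> r'" "dg W r' = 4 \<or> dg W r' = 5" "N W m = {v, p', q', r'}" for p' q' r'
  proof -
    have "1 < cost W [(m, [0]), (r', [0]), (q', [0]), (p', [0])]"
      by (rule cost_4[OF B(1,2)]) (use that B(3) in auto)
    moreover have "\<not> q' \<sim> p'" "\<not> r' \<sim> p'" "\<not> r' \<sim> q'" "m \<sim> p'" "m \<sim> q'" "m \<sim> r'"
      using that(5-7) nbr4[OF that(9)] sym by blast+
    ultimately show False
      using that dm icbrt2_bounds by (auto simp: icbrt2_powers simp del: power_Suc)
  qed
  have N: "N W v = {m, q, p, r}" "N W m = {v, q, p, r}" "N W v = {m, r, p, q}" "N W m = {v, r, p, q}"
     "N W v = {m, p, r, q}" "N W v = {m, q, r, p}" "N W m = {v, p, r, q}" "N W m = {v, q, r, p}"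
    using B(3,4) by auto
  have D: "distinct [m, q, p, r]" "distinct [m, r, p, q]" using B(5) by auto
  consider "dg W q = 4" "dg W r = 4" | "dg W p = 4" "dg W r = 4" | "dg W p = 4" "dg W q = 4"
    | "dg W p = 5" "dg W q = 5" | "dg W p = 5" "dg W r = 5" | "dg W q = 5" "dg W r = 5"
    using dv by blast
  then show False
  proof cases
    case 1 then show False using counterex_no_twins_aux[OF B] by blast
  next
    case 2 then show False using counterex_no_twins_aux[OF B(1,2) N(1,2) D(1)] by blast
  next
    case 3 then show False using counterex_no_twins_aux[OF B(1,2) N(3,4) D(2)] by blast
  next
    case 4 then show False using two5[of p q r] B n dv by auto
  next
    case 5 then show False using two5[of p r q] N B(5) n dv by auto
  next
    case 6 then show False using two5[of q r p] N B(5) n dv by auto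
  qed
qed

text \<open>The triangle \<open>q\<close>, \<open>x\<close>, \<open>y\<close> is a component after
  the loss of \<open>p\<close> with N[r] and also with N[s]. One of \<open>x\<close>,
  \<open>y\<close> misses \<open>p\<close>, and its degree forces the remaining neighbours of
  \<open>r\<close> and \<open>s\<close> to coincide, so \<open>r\<close> and \<open>s\<close> are
  adjacent twins.\<close>

lemma counterex_no_2K2:
  assumes B: "counterex W" "v \<in> W" "N W v = {p, q, r, s}" "distinct [p, q, r, s]"
    and e: "p \<sim> q" "r \<sim> s" "\<not> p \<sim> r" "\<not> p \<sim> s" "\<not> q \<sim> r" "\<not> q \<sim> s"
  shows False
proof -
  note g = counterex_hereditary[OF B(1)] and nb = nbr4[OF B(3)] and d = counterex_2K2_deg[OF B e]
  have e': "q \<sim> p" "s \<sim> r" "\<not> r \<sim> p" "\<not> s \<sim> p" "\<not> r \<sim> q" "\<not> s \<sim> q"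
    using e sym by blast+
  have B': "N W v = {p, q, s, r}" "distinct [p, q, s, r]" using B(3,4) by auto
  note t1 = counterex_2K2_tri[OF B e] and t2 = counterex_2K2_tri[OF B(1,2) B' e(1) e'(2) e(4,3,6,5)]
  have lost: "{v, p} \<subseteq> N W q" "card {v, p} = 2"
    "\<And>z. z \<in> {v, p} \<Longrightarrow> z \<in> {p} \<or> r \<sim> z" "\<And>z. z \<in> {v, p} \<Longrightarrow> z \<in> {p} \<or> s \<sim> z"
    using nb B(2) e'(1) by (auto simp: mem_N)
  obtain x y where x: "N W q = {v, p} \<union> {x, y}" "x \<sim> y" "x \<in> D (W - {p}) r" "y \<in> D (W - {p}) r"
    "N W x \<subseteq> {q, y, r} \<union> {p} \<union> N W r" "N W y \<subseteq> {q, x, r} \<union> {p} \<union> N W r"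
    by (rule triE[OF g t1 lost(1,3)]) (use d lost(2) in auto)
  obtain x2 y2 where x2: "N W q = {v, p} \<union> {x2, y2}" "x2 \<sim> y2" "x2 \<in> D (W - {p}) s" "y2 \<in> D (W - {p}) s"
    "N W x2 \<subseteq> {q, y2, s} \<union> {p} \<union> N W s" "N W y2 \<subseteq> {q, x2, s} \<union> {p} \<union> N W s"
    by (rule triE[OF g t2 lost(1,4)]) (use d lost(2) in auto)
  have W': "x \<in> W" "y \<in> W" using x(3,4) by (simp_all add: mem_D)
  have nr: "\<not> r \<sim> x" "\<not> r \<sim> y" "x \<noteq> p" "y \<noteq> p" "x \<noteq> r" "y \<noteq> r" using x(3,4) by (simp_all add: mem_D)
  then have nv: "x \<noteq> v" "y \<noteq> v" using nb by blast+
  have "x \<noteq> y" using x(2) irrefl by blast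
  moreover have "x \<in> N W q" "y \<in> N W q" using x(1) by auto
  ultimately have "(x = x2 \<and> y = y2) \<or> (x = y2 \<and> y = x2)"
    using nv nr(3,4) unfolding x2(1) by blast
  then have s: "x \<in> D (W - {p}) s" "y \<in> D (W - {p}) s"
    "N W x \<subseteq> {q, y, s} \<union> {p} \<union> N W s" "N W y \<subseteq> {q, x, s} \<union> {p} \<union> N W s"
    using x2(3-6) by blast+
  have ns: "\<not> s \<sim> x" "\<not> s \<sim> y" "x \<noteq> s" "y \<noteq> s" using s(1,2) by (simp_all add: mem_D)
  have adj: "q \<sim> x" "q \<sim> y" using nbr(2)[OF x(1)] by simp_all
  then have "x \<noteq> q" "y \<noteq> q" using irrefl by blast+
  then have "x \<notin> N W v" "y \<notin> N W v" using B(3) nr ns by auto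
  then have nv': "\<not> x \<sim> v" "\<not> y \<sim> v" using W' sym by (auto simp: mem_N)
  have vs: "{v, s} \<subseteq> N W r" "{v, r} \<subseteq> N W s" "v \<noteq> s" "v \<noteq> r" using nb B(2) e e' by (auto simp: mem_N)
  obtain r1 r2 where r: "N W r = {v, s} \<union> {r1, r2}" "r1 \<noteq> r2" "r1 \<notin> {v, s}" "r2 \<notin> {v, s}"
    using two_more[of "N W r" "{v, s}"] d vs finite_N[OF g, of r] by auto
  obtain s1 s2 where s12: "N W s = {v, r} \<union> {s1, s2}" "s1 \<noteq> s2" "s1 \<notin> {v, r}" "s2 \<notin> {v, r}"
    using two_more[of "N W s" "{v, r}"] d vs finite_N[OF g, of s] by auto
  note nr' = nr(1,2)[unfolded sym_iff[of r]] and ns' = ns(1,2)[unfolded sym_iff[of s]]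
  have Xr: "N W x \<subseteq> {q, y, p, r1, r2}"
    by (rule N_drop[OF N_drop[OF N_drop[OF _ nv'(1)] nr'(1)] ns'(1)]) (use x(5) r(1) in auto)
  have Yr: "N W y \<subseteq> {q, x, p, r1, r2}"
    by (rule N_drop[OF N_drop[OF N_drop[OF _ nv'(2)] nr'(2)] ns'(2)]) (use x(6) r(1) in auto)
  have Xs: "N W x \<subseteq> {q, y, p, s1, s2}"
    by (rule N_drop[OF N_drop[OF N_drop[OF _ nv'(1)] nr'(1)] ns'(1)]) (use s(3) s12(1) in auto)
  have Ys: "N W y \<subseteq> {q, x, p, s1, s2}"
    by (rule N_drop[OF N_drop[OF N_drop[OF _ nv'(2)] nr'(2)] ns'(2)]) (use s(4) s12(1) in auto)
  have rr: "r \<sim> r1" "r \<sim> r2" using nbr(2)[OF r(1)] by simp_all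
  have eq: "{r1, r2} = {s1, s2}"
    if z: "z \<in> W" "\<not> z \<sim> p" "N W z \<subseteq> {q, w, p, r1, r2}" "N W z \<subseteq> {q, w, p, s1, s2}" "w \<in> {x, y}" for z w
  proof -
    have "N W z \<subseteq> {q, w, r1, r2}" by (rule N_drop[OF _ z(2)]) (use z(3) in auto)
    then have 1: "N W z = {q, w, r1, r2}" by (rule N_eqI_4[rotated]) (rule counterex_deg_ge[OF B(1) z(1)])
    have "N W z \<subseteq> {q, w, s1, s2}" by (rule N_drop[OF _ z(2)]) (use z(4) in auto)
    then have 2: "N W z = {q, w, s1, s2}" by (rule N_eqI_4[rotated]) (rule counterex_deg_ge[OF B(1) z(1)])
    have "r1 \<notin> {q, w}" "r2 \<notin> {q, w}" using rr nr(1,2) e'(5) z(5) by blast+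
    then show ?thesis using 1 2 r(2) by blast
  qed
  have "\<not> (x \<sim> p \<and> y \<sim> p)" using K4[of p q x y] e(1) adj x(2) sym by blast
  then have "{r1, r2} = {s1, s2}" using eq[OF W'(1) _ Xr Xs] eq[OF W'(2) _ Yr Ys] by blast
  then have "N W r = {s, v, r1, r2}" "N W s = {r, v, r1, r2}" using r(1) s12(1) by auto
  moreover have "distinct [s, v, r1, r2]" using r vs by auto
  ultimately show False using counterex_no_twins[OF B(1) nb(3)] by blast
qed

text \<open>A centre \<open>m\<close> of degree 4 would be a twin of \<open>v\<close>. If it has
  degree 5, the sum forces degree 4 on \<open>p\<close>, and every shape of the neighbourhood of
  \<open>p\<close> is excluded already or conflicts with the degree of \<open>m\<close>.\<close>

lemma counterex_no_K13:
  assumes B: "counterex W" "v \<in> W" "N W v = {m, p, q, r}" "distinct [m, p, q, r]"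
    and e: "m \<sim> p" "m \<sim> q" "m \<sim> r"
  shows False
proof -
  note g = counterex_hereditary[OF B(1)] and nb = nbr4[OF B(3)]
  have n: "\<not> p \<sim> q" "\<not> p \<sim> r" "\<not> q \<sim> r" "\<not> q \<sim> p" "\<not> r \<sim> p" "\<not> r \<sim> q"
    using K4[of v m p q] K4[of v m p r] K4[of v m q r] nb e sym by blast+
  have sub: "{v, p, q, r} \<subseteq> N W m" using nb e B(2) by (auto simp: mem_N)
  have c4: "card {v, p, q, r} = 4" using nb B(4) by auto
  have "dg W m \<noteq> 4"
  proof
    assume "dg W m = 4"
    then have "N W m = {v, p, q, r}"
      using card_subset_eq[OF finite_N[OF g] sub] c4 by simp
    then show False using counterex_no_twins[OF B(1-3) _ B(4)] by blast
  qed
  then have m5: "dg W m = 5" using counterex_deg[OF B(1) nb(1)] by blast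
  have dv: "dg W p = 4 \<or> dg W p = 5" "dg W q = 4 \<or> dg W q = 5" "dg W r = 4 \<or> dg W r = 5"
    using counterex_deg[OF B(1)] nb by blast+
  have "1 < cost W [(m, [0]), (r, [0]), (q, [0]), (p, [0])]"
    by (rule cost_4[OF B(1,2)]) (use B in auto)
  then have p4: "dg W p = 4"
    using m5 dv e n icbrt2_bounds by (auto simp: icbrt2_powers simp del: power_Suc)
  have vm: "{v, m} \<subseteq> N W p" "v \<noteq> m" using nb e sym B(2) by (auto simp: mem_N)
  then obtain x y where xy: "N W p = {v, m} \<union> {x, y}" "x \<noteq> y" "x \<notin> {v, m}" "y \<notin> {v, m}"
    using two_more[of "N W p" "{v, m}"] p4 finite_N[OF g, of p] by auto
  have Np: "N W p = {x, y, v, m}" "distinct [x, y, v, m]" using xy vm(2) by auto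
  note np = nbr4[OF Np(1)]
  have "x \<noteq> p" "x \<noteq> q" "x \<noteq> r" "y \<noteq> p" "y \<noteq> q" "y \<noteq> r"
    using np n sym irrefl by blast+
  note ne = this
  then have "x \<notin> N W v" "y \<notin> N W v" using B(3) xy by auto
  then have nx: "\<not> x \<sim> v" "\<not> y \<sim> v" "\<not> v \<sim> x" "\<not> v \<sim> y" using np(1,2) sym by (auto simp: mem_N)
  have evm: "v \<sim> m" by (rule nb)
  have pW: "p \<in> W" by (rule nb)
  have not2: "\<not> (m \<sim> x \<and> m \<sim> y)"
  proof
    assume "m \<sim> x \<and> m \<sim> y"
    then have "{v, p, q, r, x, y} \<subseteq> N W m" using sub np by (simp add: mem_N)
    then have "card {v, p, q, r, x, y} \<le> dg W m" by (intro card_mono finite_N g)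
    moreover have "card {v, p, q, r, x, y} = 6" using c4 ne xy nb B(4) by auto
    ultimately show False using m5 by simp
  qed
  have one: False if N: "N W p = {x', y', v, m}" "distinct [x', y', v, m]" "m \<sim> x'" "\<not> m \<sim> y'" "\<not> x' \<sim> v" "\<not> y' \<sim> v" for x' y'
  proof (cases "x' \<sim> y'")
    case True
    have "N W p = {v, m, x', y'}" "distinct [v, m, x', y']" using N by auto
    then show False using counterex_no_P4[OF B(1) pW _ _ evm N(3) True] N(6) sym by blast
  next
    case False
    have "N W p = {y', v, m, x'}" "distinct [y', v, m, x']" using N by auto
    then show False
      using counterex_P3_K1_deg[OF B(1) pW _ _ evm N(3,6)] N(4) False sym[of y' m] sym[of y' x'] m5 by auto
  qed
  have Np': "N W p = {y, x, v, m}" "distinct [y, x, v, m]" using Np by auto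
  have none: "\<not> m \<sim> x" "\<not> m \<sim> y" using one[OF Np] one[OF Np'] not2 nx by blast+
  then have none': "\<not> x \<sim> m" "\<not> y \<sim> m" using sym by blast+
  show False
  proof (cases "x \<sim> y")
    case True
    show False using counterex_2K2_deg[OF B(1) pW Np True evm nx(1) none'(1) nx(2) none'(2)] m5 by simp
  next
    case False
    show False by (rule counterex_no_isolated_2[OF B(1) pW Np False nx(1) none'(1) nx(2) none'(2)])
  qed
qed

lemma counterex_no_isolated:
  assumes B: "counterex W" "v \<in> W" "N W v = {p, q, r, s}" "distinct [p, q, r, s]"
    and e: "\<not> p \<sim> q" "\<not> p \<sim> r" "\<not> p \<sim> s"
  shows False
proof -
  have N: "N W v = {p, r, q, s}" "N W v = {p, s, q, r}" "N W v = {p, r, s, q}"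
    and D: "distinct [p, r, q, s]" "distinct [p, s, q, r]" "distinct [p, r, s, q]" using B(3,4) by auto
  have t: "\<not> (q \<sim> r \<and> q \<sim> s \<and> r \<sim> s)" using K4[of v q r s] nbr4[OF B(3)] by blast
  show False
    using t counterex_no_isolated_2[OF B e] counterex_no_isolated_2[OF B(1,2) N(1) D(1) e(2,1,3)]
      counterex_no_isolated_2[OF B(1,2) N(2) D(2) e(3,1,2)]
      counterex_no_P3_K1[OF B(1-4) _ _ e] counterex_no_P3_K1[OF B(1,2) N(1) D(1) _ _ e(2,1,3)]
      counterex_no_P3_K1[OF B(1,2) N(3) D(3) _ _ e(2,3,1)] sym_iff
    by metis
qed

text \<open>A triangle-free graph on four vertices has an isolated vertex or a vertex of degree 3,
  or is a four-cycle, a path or two disjoint edges.\<close>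

lemma counterex_no_deg_4:
  assumes B: "counterex W" "v \<in> W" "dg W v = 4"
  shows False
proof -
  have iso: False if "N W v = {p, q, r, s}" "distinct [p, q, r, s]" "\<not> p \<sim> q" "\<not> p \<sim> r" "\<not> p \<sim> s" for p q r s
    using counterex_no_isolated[OF B(1,2) that] .
  have full: False if "N W v = {p, q, r, s}" "distinct [p, q, r, s]" "p \<sim> q" "p \<sim> r" "p \<sim> s" for p q r s
    using counterex_no_K13[OF B(1,2) that] .
  have edge: False if N: "N W v = {p, q, r, s}" "distinct [p, q, r, s]" "p \<sim> q" for p q r s
  proof -
    note nb = nbr4[OF N(1)]
    have P: "N W v = {q, p, r, s}" "N W v = {r, p, q, s}" "N W v = {s, p, q, r}" "N W v = {p, q, s, r}"
      "N W v = {q, p, s, r}" "N W v = {r, p, q, s}" "N W v = {s, p, q, r}" "N W v = {r, q, p, s}" "N W v = {s, q, p, r}"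
      and D: "distinct [q, p, r, s]" "distinct [r, p, q, s]" "distinct [s, p, q, r]" "distinct [p, q, s, r]"
      "distinct [q, p, s, r]" "distinct [r, p, q, s]" "distinct [s, p, q, r]" "distinct [r, q, p, s]" "distinct [s, q, p, r]"
      using N by auto
    have t: "\<not> (p \<sim> r \<and> q \<sim> r)" "\<not> (p \<sim> s \<and> q \<sim> s)"
      using K4[of v p q r] K4[of v p q s] nb N(3) by blast+
    have f: "\<not> (p \<sim> r \<and> p \<sim> s)" "\<not> (q \<sim> r \<and> q \<sim> s)"
      using full[OF N(1,2,3)] full[OF P(1) D(1) sym[OF N(3)]] by blast+
    have i: "p \<sim> r \<or> q \<sim> r \<or> r \<sim> s" "p \<sim> s \<or> q \<sim> s \<or> r \<sim> s"
      using iso[OF P(2) D(2)] iso[OF P(3) D(3)] sym by blast+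
    show False
    proof (cases "r \<sim> s")
      case True
      have x: "\<not> (p \<sim> r \<and> \<not> q \<sim> s)" "\<not> (p \<sim> s \<and> \<not> q \<sim> r)" "\<not> (q \<sim> r \<and> \<not> p \<sim> s)" "\<not> (q \<sim> s \<and> \<not> p \<sim> r)"
        using counterex_no_P4[OF B(1,2) P(1) D(1) sym[OF N(3)] _ True] counterex_no_P4[OF B(1,2) P(5) D(5) sym[OF N(3)] _ sym[OF True]]
          counterex_no_P4[OF B(1,2) N(1,2,3) _ True] counterex_no_P4[OF B(1,2) P(4) D(4) N(3) _ sym[OF True]] by blast+
      have c: "\<not> (p \<sim> r \<and> q \<sim> s)" "\<not> (p \<sim> s \<and> q \<sim> r)"
        using counterex_no_C4[OF B(1,2) P(4) D(4) N(3) _ sym[OF True]] counterex_no_C4[OF B(1,2) N(1,2,3) _ True] sym by blast+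
      show False using counterex_no_2K2[OF B(1,2) N(1,2,3) True] x c by blast
    next
      case False
      then consider "p \<sim> r" "q \<sim> s" | "q \<sim> r" "p \<sim> s" using i f t by blast
      then show False
      proof cases
        case 1
        then show False using counterex_no_P4[OF B(1,2) P(2) D(2) sym[OF 1(1)] N(3) 1(2)] False by blast
      next
        case 2
        then show False using counterex_no_P4[OF B(1,2) P(8) D(8) sym[OF 2(1)] sym[OF N(3)] 2(2)] False by blast
      qed
    qed
  qed
  have "finite (N W v)" by (rule finite_N[OF counterex_hereditary[OF B(1)]])
  then obtain xs where xs: "set xs = N W v" "distinct xs" using finite_distinct_list by blast
  then have "length xs = 4" using B(3) distinct_card[of xs] by simp
  then obtain p q r s where "xs = [p, q, r, s]"
    by (auto simp: numeral_eq_Suc length_Suc_conv)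
  then have N: "N W v = {p, q, r, s}" "distinct [p, q, r, s]" using xs by auto
  then have N': "N W v = {p, r, q, s}" "N W v = {p, s, q, r}" "distinct [p, r, q, s]" "distinct [p, s, q, r]"
    by auto
  show False using iso[OF N] edge[OF N] edge[OF N'(1,3)] edge[OF N'(2,4)] by blast
qed

subsection \<open>Vertices of degree 5\<close>

lemma counterex_deg_5: "counterex W \<Longrightarrow> x \<in> W \<Longrightarrow> dg W x = 5"
  using counterex_deg[of W x] counterex_no_deg_4[of W x] by blast

lemma nbr5:
  assumes "N W v = {p, q, r, s, t}"
  shows "p \<in> W" "q \<in> W" "r \<in> W" "s \<in> W" "t \<in> W" "v \<sim> p" "v \<sim> q" "v \<sim> r" "v \<sim> s" "v \<sim> t"
    "p \<sim> v" "q \<sim> v" "r \<sim> v" "s \<sim> v" "t \<sim> v" "p \<noteq> v" "q \<noteq> v" "r \<noteq> v" "s \<noteq> v" "t \<noteq> v"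
  using nbr[OF assms] by auto

text \<open>All degrees are 5, so a branch weighs \<open>icbrt2 ^ 6 = 1/4\<close> times a power
  counting earlier nonneighbours; the sum is scaled by 4.\<close>

lemma weight_5:
  assumes B: "counterex W" "v \<in> W" "N W v = {p, q, r, s, t}" "distinct [p, q, r, s, t]"
    and k: "k2 \<le> length (filter (\<lambda>y. \<not> q \<sim> y) [p])"
      "k3 \<le> length (filter (\<lambda>y. \<not> r \<sim> y) [q, p])"
      "k4 \<le> length (filter (\<lambda>y. \<not> s \<sim> y) [r, q, p])"
      "k5 \<le> length (filter (\<lambda>y. \<not> t \<sim> y) [s, r, q, p])"
  shows "4 < 1 + icbrt2 ^ k2 + icbrt2 ^ k3 + icbrt2 ^ k4 + icbrt2 ^ k5"
proof -
  note g = counterex_hereditary[OF B(1)] and nb = nbr5[OF B(3)]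
  have le: "icbrt2 ^ Suc (5 + k) \<le> icbrt2 ^ j / 4" if "j \<le> k" for j k
  proof -
    have "icbrt2 ^ k \<le> icbrt2 ^ j"
      using that icbrt2_pos icbrt2_bounds by (intro power_decreasing) auto
    moreover have "icbrt2 ^ Suc (5 + k) = icbrt2 ^ 6 * icbrt2 ^ k" by (simp flip: power_add)
    ultimately show ?thesis by (simp add: icbrt2_powers)
  qed
  have d: "dg W p = 5" "dg W q = 5" "dg W r = 5" "dg W s = 5" "dg W t = 5"
    using counterex_deg_5[OF B(1)] nb by blast+
  have "1 < cost W [(t, [0]), (s, [0]), (r, [0]), (q, [0]), (p, [0])]"
    using B g nb by (intro counterex_cost[of W v]) (auto simp: bd_1_D bd_1_D_empty)
  then have "1 < icbrt2 ^ Suc (5 + length (filter (\<lambda>y. \<not> t \<sim> y) [s, r, q, p]))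
     + (icbrt2 ^ Suc (5 + length (filter (\<lambda>y. \<not> s \<sim> y) [r, q, p]))
     + (icbrt2 ^ Suc (5 + length (filter (\<lambda>y. \<not> r \<sim> y) [q, p]))
     + (icbrt2 ^ Suc (5 + length (filter (\<lambda>y. \<not> q \<sim> y) [p])) + icbrt2 ^ Suc (5 + 0))))"
    unfolding cost.simps d by (simp del: filter.simps power_Suc)
  then show ?thesis using le[OF k(1)] le[OF k(2)] le[OF k(3)] le[OF k(4)] le[of 0 0] by simp
qed

section \<open>Every vertex of H has at least two neighbours in H\<close>

lemma counterex5_no_two:
  assumes B: "counterex W" "v \<in> W" "N W v = {p, k, q, r, s}" "distinct [p, k, q, r, s]"
    and n: "3 \<le> length (filter (\<lambda>y. \<not> p \<sim> y) [k, q, r, s])" "\<not> k \<sim> q" "\<not> k \<sim> r"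
  shows False
proof -
  note nb = nbr5[OF B(3)]
  have *: False if "N W v = {x, z, y, k, p}" "distinct [x, z, y, k, p]" "\<not> y \<sim> x"
    "2 \<le> length (filter (\<lambda>y. \<not> k \<sim> y) [y, z, x])" "3 \<le> length (filter (\<lambda>y. \<not> p \<sim> y) [k, y, z, x])" for x y z
  proof -
    have "1 \<le> length (filter (\<lambda>w. \<not> y \<sim> w) [z, x])" using that(3) by simp
    \<comment> \<open>These five powers sum to about 3.92. The exponent 1 comes from a nonadjacent
      pair among \<open>q\<close>, \<open>r\<close>, \<open>s\<close>, which form no
      triangle.\<close>
    from weight_5[OF B(1,2) that(1,2) _ this that(4,5), of 0]
    have "4 < 1 + icbrt2 ^ 0 + icbrt2 ^ 1 + icbrt2 ^ 2 + icbrt2 ^ 3" by blast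
    then show False using icbrt2_cube icbrt2_bounds by simp
  qed
  have N: "N W v = {q, s, r, k, p}" "N W v = {r, q, s, k, p}" "N W v = {q, r, s, k, p}"
    and D: "distinct [q, s, r, k, p]" "distinct [r, q, s, k, p]" "distinct [q, r, s, k, p]"
    using B(3,4) by auto
  have "\<not> (r \<sim> q \<and> s \<sim> r \<and> s \<sim> q)" using K4[of v q r s] nb sym by blast
  then consider "\<not> r \<sim> q" | "\<not> s \<sim> r" | "\<not> s \<sim> q" by blast
  then show False
  proof cases
    case 1
    show False by (rule *[OF N(1) D(1) 1]) (use n in \<open>auto split: if_splits\<close>)
  next
    case 2
    show False by (rule *[OF N(2) D(2) 2]) (use n in \<open>auto split: if_splits\<close>)
  next
    case 3
    show False by (rule *[OF N(3) D(3) 3]) (use n in \<open>auto split: if_splits\<close>)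
  qed
qed

text \<open>H is the four-cycle \<open>k\<close>, \<open>q\<close>, \<open>s\<close>,
  \<open>r\<close> with \<open>p\<close> attached to \<open>k\<close>. Losing N[p] takes
  \<open>v\<close> and \<open>k\<close> from \<open>q\<close>, so \<open>deg_le_3\<close> applies to
  that branch.\<close>

lemma counterex5_no_pendant:
  assumes B: "counterex W" "v \<in> W" "N W v = {p, k, q, r, s}" "distinct [p, k, q, r, s]"
    and e: "p \<sim> k" "\<not> p \<sim> q" "\<not> p \<sim> r" "\<not> p \<sim> s"
      "k \<sim> q" "k \<sim> r" "s \<sim> q" "s \<sim> r" "\<not> k \<sim> s" "\<not> q \<sim> r"
  shows False
proof -
  note g = counterex_hereditary[OF B(1)] and nb = nbr5[OF B(3)]
  have e': "k \<sim> p" "\<not> q \<sim> p" "\<not> r \<sim> p" "\<not> s \<sim> p" "q \<sim> k" "r \<sim> k" "q \<sim> s" "r \<sim> s" "\<not> s \<sim> k" "\<not> r \<sim> q"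
    using e sym by blast+
  have d: "dg W p = 5" "dg W q = 5" "dg W r = 5" "dg W s = 5" "dg W k = 5"
    using counterex_deg_5[OF B(1)] nb by blast+
  \<comment> \<open>A triangle component of \<open>q\<close> would contain its neighbour
    \<open>s\<close> and then also \<open>r\<close>, which is not adjacent to
    \<open>q\<close>.\<close>
  have "\<not> tri (D (W - {}) p) q"
  proof
    assume "tri (D (W - {}) p) q"
    then obtain x y where xy: "N (D (W - {}) p) q = {x, y}" "N (D (W - {}) p) x = {q, y}" "N (D (W - {}) p) y = {q, x}"
      unfolding tri_def by blast
    have "s \<in> {x, y}" using nb e e' B(4) by (auto simp: mem_N mem_D simp flip: xy(1))
    moreover have "r \<in> N (D (W - {}) p) s" using nb e e' B(4) by (auto simp: mem_N mem_D)
    ultimately have "r \<in> {x, y}" using xy B(4) by auto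
    then show False using nbr(2)[OF xy(1)] e by blast
  qed
  then have "bd (icbrt2 ^ 4 + icbrt2 ^ 5 + icbrt2 ^ 6) (D (W - {}) p)"
    by (rule lost_3[OF g _ _ _ _, of q _ _ "{v, k}", rotated -1])
      (use d nb e e' B(2,4) in \<open>auto simp: mem_D mem_N card_insert_if\<close>)
  then have "1 < cost W [(r, [0]), (q, [0]), (k, [0]), (s, [0]), (p, [4, 5, 6])]"
    using B g nb by (intro counterex_cost[of W v]) (auto simp: bd_1_D add.assoc)
  then show False
    using d e e' icbrt2_bounds by (auto simp: icbrt2_powers simp del: power_Suc)
qed

text \<open>By \<open>counterex5_no_two\<close> no vertex other than \<open>p\<close> misses two of
  the other three. So H without \<open>p\<close> is a four-cycle, and \<open>p\<close> is attached
  to it by at most one edge.\<close>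

lemma counterex5_no_three:
  assumes B: "counterex W" "v \<in> W" "N W v = {p, q, r, s, t}" "distinct [p, q, r, s, t]"
    and n: "\<not> p \<sim> q" "\<not> p \<sim> r" "\<not> p \<sim> s"
  shows False
proof -
  note nb = nbr5[OF B(3)]
  have two: False if "N W v = {p, k, x, y, z}" "distinct [p, k, x, y, z]" "\<not> k \<sim> x" "\<not> k \<sim> y" for k x y z
  proof (rule counterex5_no_two[OF B(1,2) that(1,2) _ that(3,4)])
    have "{k, x, y, z} = {q, r, s, t}" using that(1,2) B(3,4) by auto
    then have "card ({k, x, y, z} - {t}) = 3" using B(4) by auto
    moreover have "{k, x, y, z} - {t} \<subseteq> {w \<in> {k, x, y, z}. \<not> p \<sim> w}"
      using \<open>{k, x, y, z} = {q, r, s, t}\<close> n by auto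
    then have "card ({k, x, y, z} - {t}) \<le> card {w \<in> {k, x, y, z}. \<not> p \<sim> w}"
      by (rule card_mono[rotated]) simp
    ultimately have "3 \<le> card {w \<in> {k, x, y, z}. \<not> p \<sim> w}" by linarith
    moreover have "card (set (filter (\<lambda>w. \<not> p \<sim> w) [k, x, y, z])) = length (filter (\<lambda>w. \<not> p \<sim> w) [k, x, y, z])"
      using that(2) by (intro distinct_card distinct_filter) auto
    moreover have "set (filter (\<lambda>w. \<not> p \<sim> w) [k, x, y, z]) = {w \<in> {k, x, y, z}. \<not> p \<sim> w}"
      by (simp only: set_filter list.set)
    ultimately show "3 \<le> length (filter (\<lambda>y. \<not> p \<sim> y) [k, x, y, z])" by simp
  qed
  have fin: False if N: "N W v = {p, t, x, y, z}" "distinct [p, t, x, y, z]" and "\<not> t \<sim> z"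
    and m: "\<not> p \<sim> x" "\<not> p \<sim> y" "\<not> p \<sim> z" for x y z
  proof -
    note nb' = nbr5[OF N(1)]
    have P: "N W v = {p, t, z, x, y}" "N W v = {p, t, z, y, x}" "N W v = {p, z, t, x, y}" "N W v = {p, z, t, y, x}"
      and D: "distinct [p, t, z, x, y]" "distinct [p, t, z, y, x]" "distinct [p, z, t, x, y]" "distinct [p, z, t, y, x]"
      using N by auto
    have a: "t \<sim> x" "t \<sim> y" "z \<sim> x" "z \<sim> y"
      using two[OF P(1) D(1) \<open>\<not> t \<sim> z\<close>] two[OF P(2) D(2) \<open>\<not> t \<sim> z\<close>]
        two[OF P(3) D(3)] two[OF P(4) D(4)] \<open>\<not> t \<sim> z\<close> sym by blast+
    have xy: "\<not> x \<sim> y" using K4[of v t x y] nb' a by blast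
    show False
    proof (cases "p \<sim> t")
      case True
      then show False
        using counterex5_no_pendant[OF B(1,2) N True m a \<open>\<not> t \<sim> z\<close> xy] by blast
    next
      case False
      have Q: "N W v = {y, t, x, z, p}" "distinct [y, t, x, z, p]" using N by auto
      have "\<not> z \<sim> t" using \<open>\<not> t \<sim> z\<close> sym by blast
      then have "1 \<le> length (filter (\<lambda>w. \<not> x \<sim> w) [t, y])" "1 \<le> length (filter (\<lambda>w. \<not> z \<sim> w) [x, t, y])"
        "4 \<le> length (filter (\<lambda>w. \<not> p \<sim> w) [z, x, t, y])" using False m xy by simp_all
      \<comment> \<open>Here \<open>p\<close> is isolated in H; the powers sum to about
        3.98.\<close>
      from weight_5[OF B(1,2) Q _ this, of 0]
      have "4 < 1 + icbrt2 ^ 0 + icbrt2 ^ 1 + icbrt2 ^ 1 + icbrt2 ^ 4" by blast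
      then show False using icbrt2_powers icbrt2_bounds by simp
    qed
  qed
  have P: "N W v = {p, t, q, r, s}" "N W v = {p, t, q, s, r}" "N W v = {p, t, r, s, q}" "N W v = {p, q, r, s, t}"
    and D: "distinct [p, t, q, r, s]" "distinct [p, t, q, s, r]" "distinct [p, t, r, s, q]" "distinct [p, q, r, s, t]"
    using B(3,4) by auto
  show False
  proof (cases "t \<sim> q \<and> t \<sim> r \<and> t \<sim> s")
    case True
    then have "\<not> q \<sim> r" "\<not> q \<sim> s" using K4[of v t q r] K4[of v t q s] nb by blast+
    then show False using two[OF P(4) D(4)] by blast
  next
    case False
    then show False
      using fin[OF P(1) D(1) _ n] fin[OF P(2) D(2) _ n(1,3,2)] fin[OF P(3) D(3) _ n(2,3,1)] by blast
  qed
qed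

text \<open>Losing N[x] takes \<open>v\<close>, \<open>p\<close>, \<open>q\<close> and
  \<open>r\<close> from \<open>y\<close>, which keeps degree at most 1.\<close>

lemma counterex5_no_K23:
  assumes B: "counterex W" "v \<in> W" "N W v = {x, y, p, q, r}" "distinct [x, y, p, q, r]"
    and e: "x \<sim> p" "x \<sim> q" "x \<sim> r" "y \<sim> p" "y \<sim> q" "y \<sim> r"
  shows False
proof -
  note g = counterex_hereditary[OF B(1)] and nb = nbr5[OF B(3)]
  have e': "p \<sim> x" "q \<sim> x" "r \<sim> x" "p \<sim> y" "q \<sim> y" "r \<sim> y" "\<not> x \<sim> y" "\<not> y \<sim> x" "\<not> p \<sim> q" "\<not> p \<sim> r" "\<not> q \<sim> r"
    "\<not> q \<sim> p" "\<not> r \<sim> p" "\<not> r \<sim> q"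
    using e sym K4[of v x y p] K4[of v x p q] K4[of v x p r] K4[of v x q r] nb by blast+
  have d: "dg W p = 5" "dg W q = 5" "dg W r = 5" "dg W x = 5" "dg W y = 5"
    using counterex_deg_5[OF B(1)] nb by blast+
  have "bd (icbrt2 ^ 2) (D (W - {}) x)"
    by (rule lost_1[OF g, of y _ _ "{v, p, q, r}"])
      (use d nb e e' B(2,4) in \<open>auto simp: mem_D mem_N card_insert_if\<close>)
  then have "1 < cost W [(r, [0]), (q, [0]), (p, [0]), (y, [0]), (x, [2])]"
    using B g nb by (intro counterex_cost[of W v]) (auto simp: bd_1_D)
  then show False
    using d e e' icbrt2_bounds by (auto simp: icbrt2_powers simp del: power_Suc)
qed

section \<open>H is a five-cycle\<close>

lemma counterex5_C5_nonadj:
  assumes B: "N W v = {p, q, r, s, t}" and e: "p \<sim> q" "q \<sim> r" "r \<sim> s" "s \<sim> t" "t \<sim> p"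
  shows "\<not> p \<sim> r" "\<not> p \<sim> s" "\<not> q \<sim> s" "\<not> q \<sim> t" "\<not> r \<sim> t" "\<not> r \<sim> p" "\<not> s \<sim> p" "\<not> s \<sim> q" "\<not> t \<sim> q" "\<not> t \<sim> r"
    "q \<sim> p" "r \<sim> q" "s \<sim> r" "t \<sim> s" "p \<sim> t"
  using K4[of v p q r] K4[of v q r s] K4[of v r s t] K4[of v s t p] K4[of v t p q] nbr5[OF B] e sym by blast+

text \<open>Without \<open>p\<close> and N[r], the vertex \<open>t\<close> has lost
  \<open>v\<close>, \<open>p\<close> and \<open>s\<close> and keeps degree 2; the sum stays above 1
  only if \<open>t\<close> is in a triangle component.\<close>

lemma counterex5_C5_tri:
  assumes B: "counterex W" "v \<in> W" "N W v = {p, q, r, s, t}" "distinct [p, q, r, s, t]"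
    and e: "p \<sim> q" "q \<sim> r" "r \<sim> s" "s \<sim> t" "t \<sim> p"
  shows "tri (D (W - {p}) r) t"
proof (rule ccontr)
  assume neg: "\<not> ?thesis"
  note g = counterex_hereditary[OF B(1)] and nb = nbr5[OF B(3)] and n = counterex5_C5_nonadj[OF B(3) e]
  have d: "dg W p = 5" "dg W q = 5" "dg W r = 5" "dg W s = 5" "dg W t = 5"
    using counterex_deg_5[OF B(1)] nb by blast+
  have "bd (icbrt2 ^ 3 + icbrt2 ^ 4) (D (W - {p}) r)"
    by (rule lost_2[OF g _ _ _ _ neg, of "{v, p, s}"])
      (use d nb e n B(2,4) in \<open>auto simp: mem_D mem_N card_insert_if\<close>)
  then have "1 < cost W [(s, [0]), (q, [0]), (t, [0]), (r, [3, 4]), (p, [0])]"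
    using B g nb by (intro counterex_cost[of W v]) (auto simp: bd_1_D bd_1_D_empty)
  then show False
    using d e n icbrt2_bounds by (auto simp: icbrt2_powers simp del: power_Suc)
qed

text \<open>\<open>x\<close> and \<open>y\<close>, the outer neighbours of \<open>t\<close>, each
  miss only one of six candidates. They cannot share \<open>p\<close> or share \<open>s\<close>,
  since these are neighbours of \<open>t\<close>; hence both are adjacent to \<open>c1\<close> and
  \<open>c2\<close>, which are adjacent themselves.\<close>

lemma counterex5_no_C5:
  assumes B: "counterex W" "v \<in> W" "N W v = {p, q, r, s, t}" "distinct [p, q, r, s, t]"
    and e: "p \<sim> q" "q \<sim> r" "r \<sim> s" "s \<sim> t" "t \<sim> p"
  shows False
proof -
  note g = counterex_hereditary[OF B(1)] and nb = nbr5[OF B(3)] and n = counterex5_C5_nonadj[OF B(3) e]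
  have d: "dg W r = 5" "dg W t = 5" using counterex_deg_5[OF B(1)] nb by blast+
  have P: "N W v = {s, r, q, p, t}" "distinct [s, r, q, p, t]" "N W v = {s, t, p, q, r}" "distinct [s, t, p, q, r]"
    using B(3,4) by auto
  \<comment> \<open>The first instance confines the neighbours of \<open>x\<close> and
    \<open>y\<close>, the second keeps \<open>x\<close> and \<open>y\<close> away from
    \<open>q\<close>, and the third, at \<open>r\<close>, supplies the edge
    \<open>c1\<close>-\<open>c2\<close>.\<close>
  note t1 = counterex5_C5_tri[OF B e] and t2 = counterex5_C5_tri[OF B(1,2) P(1,2) n(13,12,11,15) n(14)]
    and t3 = counterex5_C5_tri[OF B(1,2) P(3,4) e(4,5,1,2,3)]
  have c: "card {v, p, s} = 3" "card {v, s, p} = 3" "card {v, s, q} = 3" using nb B(4) by auto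
  have lost: "{v, p, s} \<subseteq> N W t" "{v, s, p} \<subseteq> N W t" "{v, s, q} \<subseteq> N W r"
    "\<And>z. z \<in> {v, p, s} \<Longrightarrow> z \<in> {p} \<or> r \<sim> z" "\<And>z. z \<in> {v, s, p} \<Longrightarrow> z \<in> {s} \<or> q \<sim> z"
    "\<And>z. z \<in> {v, s, q} \<Longrightarrow> z \<in> {s} \<or> p \<sim> z"
    using nb B(2) e n by (auto simp: mem_N)
  obtain x y where x: "N W t = {v, p, s} \<union> {x, y}" "x \<sim> y" "x \<in> D (W - {p}) r" "y \<in> D (W - {p}) r"
    "N W x \<subseteq> {t, y, r} \<union> {p} \<union> N W r" "N W y \<subseteq> {t, x, r} \<union> {p} \<union> N W r"
    by (rule triE[OF g t1 lost(1,4)]) (use d c in auto)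
  obtain x2 y2 where x2: "N W t = {v, s, p} \<union> {x2, y2}" "x2 \<in> D (W - {s}) q" "y2 \<in> D (W - {s}) q"
    by (rule triE[OF g t2 lost(2,5)]) (use d c in auto)
  obtain c1 c2 where c12: "N W r = {v, s, q} \<union> {c1, c2}" "c1 \<sim> c2"
    by (rule triE[OF g t3 lost(3,6)]) (use d c in auto)
  have W': "x \<in> W" "y \<in> W" using x(3,4) by (simp_all add: mem_D)
  have nr: "\<not> r \<sim> x" "\<not> r \<sim> y" "x \<noteq> p" "y \<noteq> p" "x \<noteq> r" "y \<noteq> r" using x(3,4) by (simp_all add: mem_D)
  have nv: "x \<noteq> v" "y \<noteq> v" "x \<noteq> s" "y \<noteq> s" using nr(1,2) nb e(3) by blast+
  have "x \<in> N W t" "y \<in> N W t" using x(1) by auto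
  then have "x \<in> {x2, y2}" "y \<in> {x2, y2}" using nv nr unfolding x2(1) by blast+
  then have "x \<in> D (W - {s}) q" "y \<in> D (W - {s}) q" using x2(2,3) by blast+
  then have nq: "\<not> q \<sim> x" "\<not> q \<sim> y" "x \<noteq> q" "y \<noteq> q" by (simp_all add: mem_D)
  have adj: "t \<sim> x" "t \<sim> y" using nbr(2)[OF x(1)] by simp_all
  then have "x \<noteq> t" "y \<noteq> t" using irrefl by blast+
  then have "x \<notin> N W v" "y \<notin> N W v" using B(3) nr nv nq by auto
  then have nv': "\<not> x \<sim> v" "\<not> y \<sim> v" using W' sym by (auto simp: mem_N)
  note nr' = nr(1,2)[unfolded sym_iff[of r]] and nq' = nq(1,2)[unfolded sym_iff[of q]]
  have X: "N W x \<subseteq> {t, y, p, s, c1, c2}"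
    by (rule N_drop[OF N_drop[OF N_drop[OF _ nv'(1)] nr'(1)] nq'(1)]) (use x(5) c12(1) in auto)
  have Y: "N W y \<subseteq> {t, x, p, s, c1, c2}"
    by (rule N_drop[OF N_drop[OF N_drop[OF _ nv'(2)] nr'(2)] nq'(2)]) (use x(6) c12(1) in auto)
  have no_s: "w \<sim> s \<and> w \<sim> c1 \<and> w \<sim> c2"
    if "w \<in> W" "\<not> w \<sim> p" "N W w \<subseteq> {t, z, p, s, c1, c2}" for w z
  proof -
    have "N W w \<subseteq> {t, z, s, c1, c2}" by (rule N_drop[OF _ that(2)]) (use that(3) in auto)
    then have N: "N W w = {t, z, s, c1, c2}"
      by (rule N_eqI_5[rotated]) (use counterex_deg_5[OF B(1) that(1)] in simp)
    show ?thesis using nbr(2)[OF N] by simp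
  qed
  have no_p: "w \<sim> p \<and> w \<sim> c1 \<and> w \<sim> c2"
    if "w \<in> W" "\<not> w \<sim> s" "N W w \<subseteq> {t, z, p, s, c1, c2}" for w z
  proof -
    have "N W w \<subseteq> {t, z, p, c1, c2}" by (rule N_drop[OF _ that(2)]) (use that(3) in auto)
    then have N: "N W w = {t, z, p, c1, c2}"
      by (rule N_eqI_5[rotated]) (use counterex_deg_5[OF B(1) that(1)] in simp)
    show ?thesis using nbr(2)[OF N] by simp
  qed
  have k: "\<not> (x \<sim> p \<and> y \<sim> p)" "\<not> (x \<sim> s \<and> y \<sim> s)"
    using K4[of t p x y] K4[of t s x y] e n adj x(2) sym by blast+
  have "x \<sim> c1 \<and> x \<sim> c2 \<and> y \<sim> c1 \<and> y \<sim> c2"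
    using k no_s[OF W'(1) _ X] no_s[OF W'(2) _ Y] no_p[OF W'(1) _ X] no_p[OF W'(2) _ Y] by blast
  then show False using K4[of x y c1 c2] x(2) c12(2) by blast
qed

text \<open>In H every vertex has at least two neighbours. One with three or more leads to a
  complete bipartite graph on 2 and 3 vertices; otherwise H is a five-cycle.\<close>

lemma not_counterex:
  assumes B: "counterex W" "v \<in> W"
  shows False
proof -
  have n3: False if "N W v = {p, q, r, s, t}" "distinct [p, q, r, s, t]" "\<not> p \<sim> q" "\<not> p \<sim> r" "\<not> p \<sim> s" for p q r s t
    using counterex5_no_three[OF B that] .
  have a3: False if N: "N W v = {p, q, r, s, t}" "distinct [p, q, r, s, t]" "p \<sim> q" "p \<sim> r" "p \<sim> s" for p q r s t
  proof -
    note nb = nbr5[OF N(1)]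
    have n: "\<not> q \<sim> r" "\<not> q \<sim> s" "\<not> r \<sim> s" "\<not> r \<sim> q" "\<not> s \<sim> q" "\<not> s \<sim> r"
      using K4[of v p q r] K4[of v p q s] K4[of v p r s] nb N(3-5) sym by blast+
    have P: "N W v = {q, r, s, t, p}" "N W v = {r, q, s, t, p}" "N W v = {s, q, r, t, p}" "N W v = {p, t, q, r, s}"
      and D: "distinct [q, r, s, t, p]" "distinct [r, q, s, t, p]" "distinct [s, q, r, t, p]" "distinct [p, t, q, r, s]"
      using N by auto
    have "q \<sim> t" "r \<sim> t" "s \<sim> t" using n3[OF P(1) D(1)] n3[OF P(2) D(2)] n3[OF P(3) D(3)] n by blast+
    then show False using counterex5_no_K23[OF B P(4) D(4) N(3-5)] sym by blast
  qed
  have cyc: False if N: "N W v = {p, q, r, s, t}" "distinct [p, q, r, s, t]" "p \<sim> q" "p \<sim> t" "\<not> p \<sim> r" "\<not> p \<sim> s" "q \<sim> r" for p q r s t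
  proof -
    note nb = nbr5[OF N(1)]
    have P: "N W v = {q, p, r, s, t}" "N W v = {t, q, r, s, p}" "N W v = {s, p, q, r, t}" "N W v = {s, p, q, t, r}"
      and D: "distinct [q, p, r, s, t]" "distinct [t, q, r, s, p]" "distinct [s, p, q, r, t]" "distinct [s, p, q, t, r]"
      using N by auto
    have qs: "\<not> q \<sim> s" using a3[OF P(1) D(1)] sym[OF N(3)] N(7) by blast
    have qt: "\<not> q \<sim> t" using K4[of v p q t] nb N(3,4) by blast
    have st: "s \<sim> t" using n3[OF P(3) D(3)] N(6) qs sym n3[OF P(4) D(4)] by blast
    have sr: "s \<sim> r" using n3[OF P(3) D(3)] N(6) qs sym by blast
    show False using counterex5_no_C5[OF B N(1,2,3,7) sym[OF sr] st] sym[OF N(4)] by blast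
  qed
  have two: False if N: "N W v = {p, q, r, s, t}" "distinct [p, q, r, s, t]" "p \<sim> q" "p \<sim> t" "\<not> p \<sim> r" "\<not> p \<sim> s" for p q r s t
  proof -
    note nb = nbr5[OF N(1)]
    have P: "N W v = {p, q, s, r, t}" "N W v = {q, r, s, t, p}"
      and D: "distinct [p, q, s, r, t]" "distinct [q, r, s, t, p]" using N by auto
    have "\<not> q \<sim> t" using K4[of v p q t] nb N(3,4) by blast
    then have "q \<sim> r \<or> q \<sim> s" using n3[OF P(2) D(2)] by blast
    then show False using cyc[OF N] cyc[OF P(1) D(1) N(3,4,6,5)] by blast
  qed
  have "finite (N W v)" by (rule finite_N[OF counterex_hereditary[OF B(1)]])
  then obtain xs where xs: "set xs = N W v" "distinct xs" using finite_distinct_list by blast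
  then have "length xs = 5" using counterex_deg_5[OF B] distinct_card[of xs] by simp
  then obtain p q r s t where "xs = [p, q, r, s, t]"
    by (auto simp: numeral_eq_Suc length_Suc_conv)
  then have N: "N W v = {p, q, r, s, t}" "distinct [p, q, r, s, t]" using xs by auto
  then have P: "N W v = {p, q, r, t, s}" "N W v = {p, q, s, t, r}" "N W v = {p, r, s, t, q}"
    "N W v = {p, r, q, t, s}" "N W v = {p, s, q, r, t}" "N W v = {p, r, q, s, t}"
    and D: "distinct [p, q, r, t, s]" "distinct [p, q, s, t, r]" "distinct [p, r, s, t, q]"
    "distinct [p, r, q, t, s]" "distinct [p, s, q, r, t]" "distinct [p, r, q, s, t]" by auto
  note n = n3[OF N] n3[OF P(1) D(1)] n3[OF P(2) D(2)] n3[OF P(3) D(3)]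
  note a = a3[OF N] a3[OF P(1) D(1)] a3[OF P(2) D(2)] a3[OF P(3) D(3)]
  note t = two[OF N] two[OF P(1) D(1)] two[OF P(2) D(2)] two[OF P(4) D(4)] two[OF P(5) D(5)] two[OF P(6) D(6)]
  show False
    by (cases "p \<sim> q"; cases "p \<sim> r"; cases "p \<sim> s"; cases "p \<sim> t") (use n a t in blast)+
qed

section \<open>The two bounds for the abstract invariant\<close>

theorem b_le:
  assumes "finite W"
  shows "b W \<le> cbrt2 ^ card W"
proof -
  have "bd 1 W" using assms
  proof (induction rule: finite_psubset_induct)
    case (psubset W)
    then have g: "hereditary W" by (simp add: hereditary_def)
    show ?case
    proof (cases "W = {}")
      case True
      then show ?thesis using empty by (simp add: bd_def)
    next
      case False
      then show ?thesis using not_counterex[of W] g by (auto simp: counterex_def)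
    qed
  qed
  then show ?thesis by (simp add: bd_def)
qed

theorem b_le_low_degree:
  assumes "finite W" "v \<in> W" "dg W v \<le> 3" "\<not> tri W v"
  shows "b W \<le> (icbrt2 ^ 4 + icbrt2 ^ 5 + icbrt2 ^ 6) * cbrt2 ^ card W"
proof -
  \<comment> \<open>By \<open>b_le\<close> every finite set is hereditary, so the conditional bound
    of \<open>deg_le_3\<close> becomes unconditional.\<close>
  have "hereditary W" using assms(1) b_le by (auto simp: hereditary_def bd_def intro: finite_subset)
  then show ?thesis using deg_le_3[OF _ assms(2-4)] by (simp add: bd_def \<alpha>_def)
qed

end

section \<open>Transfer to the independence complex\<close>

context K4_free_subadditive
begin

lemma tri_triangle_component:
  assumes "R = adj E" "v \<in> V" "tri V v"
  shows "triangle_component V E v"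
proof -
  have R: "adj E x y \<longleftrightarrow> x \<sim> y" for x y using assms(1) by simp
  obtain x y where xy: "N V v = {x, y}" "N V x = {v, y}" "N V y = {v, x}"
    using assms(3) unfolding tri_def by blast
  let ?r = "\<lambda>x y. x \<in> V \<and> y \<in> V \<and> adj E x y"
  have adj: "v \<sim> x" "v \<sim> y" "x \<sim> y" "x \<in> V" "y \<in> V"
    using nbr[OF xy(1)] nbr[OF xy(2)] by auto
  have closed: "w \<in> {v, x, y}" if "?r\<^sup>*\<^sup>* v w" for w
    using that
  proof induction
    case (step w z)
    then have "z \<in> N V w" by (simp add: mem_N R)
    then show ?case using step.IH xy by auto
  qed simp
  have "?r v x" "?r v y" using adj assms(2) by (simp_all add: R)
  then have "component V E v = {v, x, y}"
    unfolding component_def using closed by (auto intro: r_into_rtranclp)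
  moreover have "v \<noteq> x" "v \<noteq> y" "x \<noteq> y" using adj irrefl by auto
  ultimately show ?thesis
    unfolding triangle_component_def R using adj(1-3) adj(1-3)[THEN sym] by auto
qed

end

theorem theoremA2:
  fixes V :: "'a::linorder set" and E :: "'a set set"
  assumes "simple_graph V E" and "K4_free V E"
  shows "real (btilde TYPE('k::field) V E) \<le> 2 powr (real (card V) / 3) \<and>
         ((\<exists>v\<in>V. degree E v \<le> 3 \<and> \<not> triangle_component V E v) \<longrightarrow>
          real (btilde TYPE('k::field) V E)
           \<le> ((2 powr (1/3)) powr (-4) + (2 powr (1/3)) powr (-5) + (2 powr (1/3)) powr (-6))
              * (2 powr (1/3)) powr real (card V))"
proof -
  have V: "finite V" and E: "\<forall>e\<in>E. e \<subseteq> V \<and> card e = 2"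
    using assms(1) by (auto simp: simple_graph_def)
  then have E2: "\<forall>e\<in>E. card e = 2" by blast
  have in_V: "x \<in> V" "y \<in> V" "x \<noteq> y" if "adj E x y" for x y
    using that E by (auto simp: adj_def)
  \<comment> \<open>The edge set stays \<open>E\<close> for every \<open>W\<close>: a subset of
    \<open>W\<close> contains only edges with both ends in \<open>W\<close>, so this is the
    invariant of the induced subgraph.\<close>
  let ?b = "\<lambda>W. real (btilde TYPE('k) W E)"
  interpret K4_free_subadditive "adj E" ?b
  proof
    show "adj E y x" if "adj E x y" for x y using that by (simp add: adj_def insert_commute)
    note symI = this
    show "\<not> adj E x x" for x using in_V(3) by blast
    show False if a: "adj E w x" "adj E w y" "adj E w z" "adj E x y" "adj E x z" "adj E y z" for w x y z
    proof -
      note ne = in_V(3)[OF a(1)] in_V(3)[OF a(2)] in_V(3)[OF a(3)] in_V(3)[OF a(4)] in_V(3)[OF a(5)] in_V(3)[OF a(6)]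
      have "{w, x, y, z} \<subseteq> V" using in_V a by blast
      moreover have "card {w, x, y, z} = 4" using ne by auto
      moreover have "\<forall>p\<in>{w, x, y, z}. \<forall>q\<in>{w, x, y, z}. p \<noteq> q \<longrightarrow> adj E p q"
        using a a[THEN symI] by auto
      ultimately show False using assms(2) unfolding K4_free_def by blast
    qed
    show "?b W \<le> ?b (W - {v}) + ?b (W - insert v {y. adj E v y})" if "finite W" "v \<in> W" for W v
      using btilde_deletion_link[OF E2 that(2,1), of "TYPE('k)"] by linarith
    show "?b W = 0" if "finite W" "v \<in> W" "\<And>y. y \<in> W \<Longrightarrow> \<not> adj E v y" for W v
      using btilde_isolated[OF E2 that(2,1,3)] by simp
    show "?b {} \<le> 1" using btilde_empty[of "TYPE('k)" E] by simp
  qed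
  have pow: "cbrt2 ^ n = (2 powr (1/3)) powr real n" for n
    by (simp add: cbrt2_def powr_realpow)
  have ipow: "icbrt2 ^ n = (2 powr (1/3)) powr (- real n)" for n
    by (simp add: icbrt2_def power_inverse pow powr_minus)
  have "?b V \<le> 2 powr (real (card V) / 3)"
    using b_le[OF V] by (simp add: pow powr_powr)
  moreover have "?b V \<le> ((2 powr (1/3)) powr (-4) + (2 powr (1/3)) powr (-5) + (2 powr (1/3)) powr (-6))
      * (2 powr (1/3)) powr real (card V)"
    if v: "v \<in> V" "degree E v \<le> 3" "\<not> triangle_component V E v" for v
  proof -
    have "N V v = {u. adj E v u}" using in_V by (auto simp: N_def)
    then have "dg V v \<le> 3" using v(2) by (simp add: degree_def)
    moreover have "\<not> tri V v" using tri_triangle_component[OF refl v(1)] v(3) by blast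
    ultimately show ?thesis
      using b_le_low_degree[OF V v(1)] by (simp add: ipow pow)
  qed
  ultimately show ?thesis by blast
qed

end
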